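(* Let $M$ be a Turing machine that halts on every binary input and such that the following five formulas are provable in ZFC: (1) $\forall r,s\,(\|s\|=\|r\|\to M(s)=M(r))$; (2) $\forall r,s\,(\|s\|>\|r\|\to(M(s)=1\to M(r)=1))$; (3) $\forall r,s\,(\|s\|>\|r\|\to(M(r)=0\to M(s)=0))$; (4) $\forall s\,(M(s)=0\vee M(s)=1)$; (5) $\forall s\,(M(s)=1)\vee\exists m\,\forall s\,\big((\|s\|<m\to M(s)=1)\wedge(\|s\|\ge m\to M(s)=0)\big)$ (all quantifiers over binary strings), and such that the statement $\forall s\,(M(s)=1)$ is independent of ZFC. Then $\mathbf{FS}(M,s,1)$ is unbounded on binary strings $s$: for every $m$ there is a binary string $s$ with $\mathbf{FS}(M,s,1)>m$.
   Context: Turing machines: $M=(Q,\Gamma,\delta,q_0,q_{halt})$ with finite state set $Q$, tape alphabet $\Gamma=\{0,1,\sqcup,\triangleright\}$ ($\sqcup$ blank, $\triangleright$ left-end marker), transition function $\delta:Q\times\Gamma\to Q\times\Gamma\times\{L,S,R\}$, start state $q_0$, halting state $q_{halt}$; $\|s\|$ is the length of a binary string $s$. Formulas of set theory are written as ASCII strings via a fixed LaTeX encoding; $\mathrm{asciilen}(\varphi)$ is the number of characters in the shortest representation; for $\pi=\langle\varphi_0,\dots,\varphi_n\rangle$, $\|\pi\|_{as}=\sum_i\mathrm{asciilen}(\varphi_i)$. Proofs from a recursive theory: for $\langle T,al\rangle$ with $T$ a set of formulas and $al$ an algorithm deciding membership in $T$, $\langle T,al\rangle\vdash^{\pi}\varphi$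 means $\pi=\langle\varphi_0,\dots,\varphi_n\rangle$, $\varphi_n=\varphi$, and each $\varphi_i$ is a logical axiom (standard first-order list: tautologies, quantifier axioms, equality axioms), an axiom of ZFC, a member of $T$, obtained by modus ponens ($\varphi_j=(\varphi_k\to\varphi_i)$ for some $j,k<i$), or $\forall x_k\varphi_j$ for some $j<i$. Formalization of computations: for binary $s=s_0\dots s_l$, a constant $t$ denotes the computation table of $M$ on $s$: $t_{i,j}\in\Gamma\times Q\times\{0,1\}$ records, at step $i$, the symbol in cell $j$, the current state, and whether the head is on cell $j$. $\mathbf{def}_M$ is a fixed finite formula sequence depending only on $M$ asserting that $t$ is a table of $M$ (cell $0$ always holds $\triangleright$, exactly one head position per row, consecutive rows related by $\delta$, initial row consists of finitely many non-blank cells followed by blanks). $\mathbf{input}_s$ is the sequence $\forall j\,(j>l+1\to t_{0,j}=(\sqcup,q_0,0))$, $t_{0,0}=(\triangleright,q_0,1)$, $t_{0,1}=(s_0,q_0,0)$, …, $t_{0,l+1}=(s_l,q_0,0)$. $\mathbf{T}_{\langle M,s\rangle}$ is $\mathbf{def}_M$ followed by $\mathbf{input}_s$, and $\mathbf{AL}$ decides membership in $\mathbf{T}_{\langle M,s\rangle}$ by comparing a formula successively with its entries. A normal proof of $M(s)=v$ is a formula sequence $\pi$ with $\langle\mathbf{T}_{\langle M,s\rangle},\mathbf{AL}\rangle\vdash^{\pi}\exists i\,t_{i,1}=(v,q_{halt},1)$. $\mathbf{FS}(M,s,v)$ is the minimum of $\|\pi\|_{as}$ over all normal proofs $\pi$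 of $M(s)=v$. *)

theory Defs
  imports Main "HOL-Library.Extended_Nat"
begin

section \<open>Turing machines\<close>

datatype sym = Zero | One | Blank | LeftEnd

datatype dir = MoveL | Stay | MoveR

text \<open>A finite state set is, up to renaming, a finite set of natural numbers; the number is also
  the name of the state inside set theory.\<close>

record turing_machine =
  states :: "nat set"
  delta :: "nat \<Rightarrow> sym \<Rightarrow> nat \<times> sym \<times> dir"
  start :: nat
  halt :: nat

definition is_TM :: "turing_machine \<Rightarrow> bool" where
  "is_TM M \<longleftrightarrow> finite (states M) \<and> start M \<in> states M \<and> halt M \<in> states M \<and>
     (\<forall>q\<in>states M. \<forall>a. fst (delta M q a) \<in> states M)"

text \<open>Nothing changes any more once the halting state has been reached.\<close>

definition action :: "turing_machine \<Rightarrow> nat \<Rightarrow> sym \<Rightarrow> nat \<times> sym \<times> dir" where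
  "action M q a = (if q = halt M then (q, a, Stay) else delta M q a)"

text \<open>A configuration consists of state, head position and tape contents.  Cell \<open>0\<close> always holds the
  left-end marker, so writing there has no effect, and a left move from cell \<open>0\<close> leaves the head
  there (truncated subtraction).\<close>

type_synonym config = "nat \<times> nat \<times> (nat \<Rightarrow> sym)"

fun move :: "dir \<Rightarrow> nat \<Rightarrow> nat" where
  "move MoveL p = p - 1"
| "move Stay p = p"
| "move MoveR p = p + 1"

fun step :: "turing_machine \<Rightarrow> config \<Rightarrow> config" where
  "step M (q, p, f) =
     (let (q', a, d) = action M q (f p)
      in (q', move d p, f(p := if p = 0 then LeftEnd else a)))"

type_synonym bitstring = "bool list"

definition bit_sym :: "bool \<Rightarrow> sym" where
  "bit_sym b = (if b then One else Zero)"

definition init_tape :: "bitstring \<Rightarrow> nat \<Rightarrow> sym" where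
  "init_tape s j = (if j = 0 then LeftEnd else if j \<le> length s then bit_sym (s ! (j - 1)) else Blank)"

definition init_config :: "turing_machine \<Rightarrow> bitstring \<Rightarrow> config" where
  "init_config M s = (start M, 0, init_tape s)"

definition halts_on :: "turing_machine \<Rightarrow> bitstring \<Rightarrow> bool" where
  "halts_on M s \<longleftrightarrow> (\<exists>n. fst ((step M ^^ n) (init_config M s)) = halt M)"


section \<open>Formulas of set theory\<close>

text \<open>\<open>Tab\<close> is the constant \<open>t\<close> denoting the computation table.\<close>

datatype tm = Var nat | Tab

datatype fm =
    Eq tm tm (infix \<open>\<^bold>=\<close> 50)
  | Mem tm tm (infix \<open>\<^bold>\<in>\<close> 50)
  | Neg fm (\<open>\<^bold>\<not> _\<close> [40] 40)
  | Imp fm fm (infixr \<open>\<^bold>\<longrightarrow>\<close> 25)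
  | Forall nat fm

definition Con :: "fm \<Rightarrow> fm \<Rightarrow> fm" (infixr \<open>\<^bold>\<and>\<close> 35) where
  "Con A B = Neg (Imp A (Neg B))"

definition Dis :: "fm \<Rightarrow> fm \<Rightarrow> fm" (infixr \<open>\<^bold>\<or>\<close> 30) where
  "Dis A B = Imp (Neg A) B"

definition Iff :: "fm \<Rightarrow> fm \<Rightarrow> fm" (infixr \<open>\<^bold>\<longleftrightarrow>\<close> 25) where
  "Iff A B = Con (Imp A B) (Imp B A)"

definition Exists :: "nat \<Rightarrow> fm \<Rightarrow> fm" where
  "Exists x A = Neg (Forall x (Neg A))"

fun fv_tm :: "tm \<Rightarrow> nat set" where
  "fv_tm (Var x) = {x}"
| "fv_tm Tab = {}"

fun fv :: "fm \<Rightarrow> nat set" where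
  "fv (Eq a b) = fv_tm a \<union> fv_tm b"
| "fv (Mem a b) = fv_tm a \<union> fv_tm b"
| "fv (Neg A) = fv A"
| "fv (Imp A B) = fv A \<union> fv B"
| "fv (Forall x A) = fv A - {x}"

fun all_vars :: "fm \<Rightarrow> nat set" where
  "all_vars (Eq a b) = fv_tm a \<union> fv_tm b"
| "all_vars (Mem a b) = fv_tm a \<union> fv_tm b"
| "all_vars (Neg A) = all_vars A"
| "all_vars (Imp A B) = all_vars A \<union> all_vars B"
| "all_vars (Forall x A) = insert x (all_vars A)"

text \<open>Formulas of the language with \<open>\<in>\<close> only, without the constant \<open>t\<close>.\<close>

fun pure :: "fm \<Rightarrow> bool" where
  "pure (Eq a b) \<longleftrightarrow> a \<noteq> Tab \<and> b \<noteq> Tab"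
| "pure (Mem a b) \<longleftrightarrow> a \<noteq> Tab \<and> b \<noteq> Tab"
| "pure (Neg A) \<longleftrightarrow> pure A"
| "pure (Imp A B) \<longleftrightarrow> pure A \<and> pure B"
| "pure (Forall x A) \<longleftrightarrow> pure A"

fun subst_tm :: "nat \<Rightarrow> tm \<Rightarrow> tm \<Rightarrow> tm" where
  "subst_tm x u (Var y) = (if y = x then u else Var y)"
| "subst_tm x u Tab = Tab"

text \<open>Substitution of \<open>u\<close> for the free occurrences of \<open>x\<close>; it is meaningful only if \<open>u\<close> is
  free for \<open>x\<close>, see \<open>free_for\<close>.\<close>

fun subst :: "nat \<Rightarrow> tm \<Rightarrow> fm \<Rightarrow> fm" where
  "subst x u (Eq a b) = Eq (subst_tm x u a) (subst_tm x u b)"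
| "subst x u (Mem a b) = Mem (subst_tm x u a) (subst_tm x u b)"
| "subst x u (Neg A) = Neg (subst x u A)"
| "subst x u (Imp A B) = Imp (subst x u A) (subst x u B)"
| "subst x u (Forall y A) = (if y = x then Forall y A else Forall y (subst x u A))"

fun free_for :: "tm \<Rightarrow> nat \<Rightarrow> fm \<Rightarrow> bool" where
  "free_for u x (Eq a b) \<longleftrightarrow> True"
| "free_for u x (Mem a b) \<longleftrightarrow> True"
| "free_for u x (Neg A) \<longleftrightarrow> free_for u x A"
| "free_for u x (Imp A B) \<longleftrightarrow> free_for u x A \<and> free_for u x B"
| "free_for u x (Forall y A) \<longleftrightarrow> x \<notin> fv (Forall y A) \<or> (y \<notin> fv_tm u \<and> free_for u x A)"


section \<open>Length of formulas written in LaTeX\<close>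

definition digit :: "nat \<Rightarrow> char" where
  "digit d = char_of (48 + d)"

fun decimal :: "nat \<Rightarrow> string" where
  "decimal n = (if n < 10 then [digit n] else decimal (n div 10) @ [digit (n mod 10)])"

declare decimal.simps [simp del]

text \<open>A LaTeX control word: backslash, name, terminating space.\<close>

definition ctrl :: "string \<Rightarrow> string" where
  "ctrl w = CHR 0x5C # w @ '' ''"

inductive ascii_tm :: "tm \<Rightarrow> string \<Rightarrow> bool" where
  "k < 10 \<Longrightarrow> ascii_tm (Var k) (''x_'' @ decimal k)"
| "ascii_tm (Var k) (''x_{'' @ decimal k @ ''}'')"
| "ascii_tm Tab ''t''"

text \<open>A formula may have several representations: braces around one-digit subscripts are
  optional, and the defined connectives may be written as such or be expanded.\<close>

inductive ascii :: "fm \<Rightarrow> string \<Rightarrow> bool" where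
  "ascii_tm a u \<Longrightarrow> ascii_tm b v \<Longrightarrow> ascii (Eq a b) (u @ ''='' @ v)"
| "ascii_tm a u \<Longrightarrow> ascii_tm b v \<Longrightarrow> ascii (Mem a b) (u @ ctrl ''in'' @ v)"
| "ascii A u \<Longrightarrow> ascii (Neg A) (ctrl ''neg'' @ u)"
| "ascii A u \<Longrightarrow> ascii B v \<Longrightarrow> ascii (Imp A B) (''('' @ u @ ctrl ''to'' @ v @ '')'')"
| "ascii A u \<Longrightarrow> ascii B v \<Longrightarrow> ascii (Con A B) (''('' @ u @ ctrl ''land'' @ v @ '')'')"
| "ascii A u \<Longrightarrow> ascii B v \<Longrightarrow> ascii (Dis A B) (''('' @ u @ ctrl ''lor'' @ v @ '')'')"
| "ascii A u \<Longrightarrow> ascii B v \<Longrightarrow> ascii (Iff A B) (''('' @ u @ ctrl ''leftrightarrow'' @ v @ '')'')"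
| "ascii_tm (Var x) u \<Longrightarrow> ascii A v \<Longrightarrow> ascii (Forall x A) (ctrl ''forall'' @ u @ v)"
| "ascii_tm (Var x) u \<Longrightarrow> ascii A v \<Longrightarrow> ascii (Exists x A) (ctrl ''exists'' @ u @ v)"

definition asciilen :: "fm \<Rightarrow> nat" where
  "asciilen A = (LEAST n. \<exists>w. ascii A w \<and> length w = n)"

definition ascii_norm :: "fm list \<Rightarrow> nat" where
  "ascii_norm \<pi> = (\<Sum>A\<leftarrow>\<pi>. asciilen A)"


section \<open>Set-theoretic notions\<close>

text \<open>\<open>fresh\<close> yields a variable not occurring in the given terms.  In \<open>AllF ts P\<close> and \<open>ExF ts P\<close> the
  list \<open>ts\<close> always contains all terms (other than the bound variable) from which the body is built.\<close>

definition fresh :: "tm list \<Rightarrow> nat" where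
  "fresh ts = Suc (Max (insert 0 (\<Union>u\<in>set ts. fv_tm u)))"

definition AllF :: "tm list \<Rightarrow> (tm \<Rightarrow> fm) \<Rightarrow> fm" where
  "AllF ts P = Forall (fresh ts) (P (Var (fresh ts)))"

definition ExF :: "tm list \<Rightarrow> (tm \<Rightarrow> fm) \<Rightarrow> fm" where
  "ExF ts P = Exists (fresh ts) (P (Var (fresh ts)))"

definition is_empty :: "tm \<Rightarrow> fm" where
  "is_empty a = AllF [a] (\<lambda>z. \<^bold>\<not> z \<^bold>\<in> a)"

text \<open>\<open>a = b \<union> {b}\<close>\<close>

definition is_succ :: "tm \<Rightarrow> tm \<Rightarrow> fm" where
  "is_succ a b = AllF [a, b] (\<lambda>z. z \<^bold>\<in> a \<^bold>\<longleftrightarrow> z \<^bold>\<in> b \<^bold>\<or> z \<^bold>= b)"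

text \<open>\<open>c = {a, b}\<close>\<close>

definition is_upair :: "tm \<Rightarrow> tm \<Rightarrow> tm \<Rightarrow> fm" where
  "is_upair c a b = AllF [c, a, b] (\<lambda>z. z \<^bold>\<in> c \<^bold>\<longleftrightarrow> z \<^bold>= a \<^bold>\<or> z \<^bold>= b)"

text \<open>\<open>c = (a, b)\<close>, Kuratowski pairs\<close>

definition is_pair :: "tm \<Rightarrow> tm \<Rightarrow> tm \<Rightarrow> fm" where
  "is_pair c a b = ExF [c, a, b] (\<lambda>u. ExF [c, a, b, u] (\<lambda>v.
     is_upair u a a \<^bold>\<and> is_upair v a b \<^bold>\<and> is_upair c u v))"

text \<open>\<open>c = (a, b, d) = ((a, b), d)\<close>\<close>

definition is_triple :: "tm \<Rightarrow> tm \<Rightarrow> tm \<Rightarrow> tm \<Rightarrow> fm" where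
  "is_triple c a b d = ExF [c, a, b, d] (\<lambda>p. is_pair p a b \<^bold>\<and> is_pair c p d)"

definition is_inductive :: "tm \<Rightarrow> fm" where
  "is_inductive w = (
     ExF [w] (\<lambda>z. is_empty z \<^bold>\<and> z \<^bold>\<in> w) \<^bold>\<and>
     AllF [w] (\<lambda>x. x \<^bold>\<in> w \<^bold>\<longrightarrow> ExF [w, x] (\<lambda>y. is_succ y x \<^bold>\<and> y \<^bold>\<in> w)))"

text \<open>\<open>a \<in> \<omega>\<close>\<close>

definition is_nat :: "tm \<Rightarrow> fm" where
  "is_nat a = AllF [a] (\<lambda>w. is_inductive w \<^bold>\<longrightarrow> a \<^bold>\<in> w)"

text \<open>\<open>a\<close> is the von Neumann numeral \<open>n\<close>; \<open>ExNum ts n P\<close> expresses \<open>P(n)\<close>.\<close>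

fun is_num :: "nat \<Rightarrow> tm \<Rightarrow> fm" where
  "is_num 0 a = is_empty a"
| "is_num (Suc n) a = ExF [a] (\<lambda>b. is_num n b \<^bold>\<and> is_succ a b)"

definition ExNum :: "tm list \<Rightarrow> nat \<Rightarrow> (tm \<Rightarrow> fm) \<Rightarrow> fm" where
  "ExNum ts n P = ExF ts (\<lambda>x. is_num n x \<^bold>\<and> P x)"

text \<open>\<open>(a, b) \<in> f\<close>, i.e. \<open>f(a) = b\<close> for a function \<open>f\<close>\<close>

definition is_app :: "tm \<Rightarrow> tm \<Rightarrow> tm \<Rightarrow> fm" where
  "is_app f a b = ExF [f, a, b] (\<lambda>z. is_pair z a b \<^bold>\<and> z \<^bold>\<in> f)"


subsection \<open>The axioms of ZFC\<close>

definition ax_extensionality :: fm where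
  "ax_extensionality = AllF [] (\<lambda>a. AllF [a] (\<lambda>b.
     AllF [a, b] (\<lambda>x. x \<^bold>\<in> a \<^bold>\<longleftrightarrow> x \<^bold>\<in> b) \<^bold>\<longrightarrow> a \<^bold>= b))"

definition ax_foundation :: fm where
  "ax_foundation = AllF [] (\<lambda>a. ExF [a] (\<lambda>x. x \<^bold>\<in> a) \<^bold>\<longrightarrow>
     ExF [a] (\<lambda>x. x \<^bold>\<in> a \<^bold>\<and> \<^bold>\<not> ExF [a, x] (\<lambda>y. y \<^bold>\<in> x \<^bold>\<and> y \<^bold>\<in> a)))"

definition ax_pairing :: fm where
  "ax_pairing = AllF [] (\<lambda>a. AllF [a] (\<lambda>b. ExF [a, b] (\<lambda>c. is_upair c a b)))"

definition ax_union :: fm where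
  "ax_union = AllF [] (\<lambda>a. ExF [a] (\<lambda>u. AllF [a, u] (\<lambda>x.
     x \<^bold>\<in> u \<^bold>\<longleftrightarrow> ExF [a, u, x] (\<lambda>y. x \<^bold>\<in> y \<^bold>\<and> y \<^bold>\<in> a))))"

definition ax_powerset :: fm where
  "ax_powerset = AllF [] (\<lambda>a. ExF [a] (\<lambda>p. AllF [a, p] (\<lambda>x.
     x \<^bold>\<in> p \<^bold>\<longleftrightarrow> AllF [a, p, x] (\<lambda>y. y \<^bold>\<in> x \<^bold>\<longrightarrow> y \<^bold>\<in> a))))"

definition ax_infinity :: fm where
  "ax_infinity = ExF [] is_inductive"

text \<open>Every set of nonempty, pairwise disjoint sets has a transversal.\<close>

definition ax_choice :: fm where
  "ax_choice = AllF [] (\<lambda>a.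
     AllF [a] (\<lambda>x. x \<^bold>\<in> a \<^bold>\<longrightarrow> ExF [a, x] (\<lambda>z. z \<^bold>\<in> x)) \<^bold>\<and>
     AllF [a] (\<lambda>x. AllF [a, x] (\<lambda>y. x \<^bold>\<in> a \<^bold>\<and> y \<^bold>\<in> a \<^bold>\<and> \<^bold>\<not> x \<^bold>= y \<^bold>\<longrightarrow>
       \<^bold>\<not> ExF [a, x, y] (\<lambda>z. z \<^bold>\<in> x \<^bold>\<and> z \<^bold>\<in> y)))
     \<^bold>\<longrightarrow> ExF [a] (\<lambda>c. AllF [a, c] (\<lambda>x. x \<^bold>\<in> a \<^bold>\<longrightarrow>
       ExF [a, c, x] (\<lambda>z. z \<^bold>\<in> x \<^bold>\<and> z \<^bold>\<in> c \<^bold>\<and>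
         AllF [a, c, x, z] (\<lambda>z'. z' \<^bold>\<in> x \<^bold>\<and> z' \<^bold>\<in> c \<^bold>\<longrightarrow> z' \<^bold>= z)))))"

text \<open>The parameters of the two schemes are left free; generalization yields the universal closures.\<close>

inductive ZFC_axiom :: "fm \<Rightarrow> bool" where
  extensionality: "ZFC_axiom ax_extensionality"
| foundation: "ZFC_axiom ax_foundation"
| pairing: "ZFC_axiom ax_pairing"
| union: "ZFC_axiom ax_union"
| powerset: "ZFC_axiom ax_powerset"
| infinity: "ZFC_axiom ax_infinity"
| choice: "ZFC_axiom ax_choice"
| separation: "pure A \<Longrightarrow> distinct [x, y, a] \<Longrightarrow> y \<notin> fv A \<Longrightarrow>
    ZFC_axiom (Forall a (Exists y (Forall x (Var x \<^bold>\<in> Var y \<^bold>\<longleftrightarrow> Var x \<^bold>\<in> Var a \<^bold>\<and> A))))"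
| replacement: "pure A \<Longrightarrow> distinct [x, y, y', a, b] \<Longrightarrow> b \<notin> fv A \<Longrightarrow> y' \<notin> all_vars A \<Longrightarrow>
    ZFC_axiom (Forall a
      (Forall x (Var x \<^bold>\<in> Var a \<^bold>\<longrightarrow>
         Forall y (Forall y' (A \<^bold>\<and> subst y (Var y') A \<^bold>\<longrightarrow> Var y \<^bold>= Var y')))
       \<^bold>\<longrightarrow> Exists b (Forall y (Var y \<^bold>\<in> Var b \<^bold>\<longleftrightarrow> Exists x (Var x \<^bold>\<in> Var a \<^bold>\<and> A)))))"


section \<open>Proofs\<close>

text \<open>Propositional evaluation: atomic and quantified formulas are the propositional variables.\<close>

fun peval :: "(fm \<Rightarrow> bool) \<Rightarrow> fm \<Rightarrow> bool" where
  "peval v (Neg A) \<longleftrightarrow> \<not> peval v A"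
| "peval v (Imp A B) \<longleftrightarrow> (peval v A \<longrightarrow> peval v B)"
| "peval v A \<longleftrightarrow> v A"

definition tautology :: "fm \<Rightarrow> bool" where
  "tautology A \<longleftrightarrow> (\<forall>v. peval v A)"

inductive logical_axiom :: "fm \<Rightarrow> bool" where
  taut: "tautology A \<Longrightarrow> logical_axiom A"
| inst: "free_for u x A \<Longrightarrow> logical_axiom (Forall x A \<^bold>\<longrightarrow> subst x u A)"
| distr: "x \<notin> fv A \<Longrightarrow> logical_axiom (Forall x (A \<^bold>\<longrightarrow> B) \<^bold>\<longrightarrow> (A \<^bold>\<longrightarrow> Forall x B))"
| eq_refl: "logical_axiom (u \<^bold>= u)"
| eq_subst: "free_for u x A \<Longrightarrow> free_for v x A \<Longrightarrow>
    logical_axiom (u \<^bold>= v \<^bold>\<longrightarrow> (subst x u A \<^bold>\<longrightarrow> subst x v A))"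

text \<open>A theory comes with a decision procedure for membership.\<close>

type_synonym rec_theory = "fm set \<times> (fm \<Rightarrow> bool)"

definition proves :: "rec_theory \<Rightarrow> fm list \<Rightarrow> fm \<Rightarrow> bool" where
  "proves T \<pi> A \<longleftrightarrow> (\<forall>B. snd T B \<longleftrightarrow> B \<in> fst T) \<and> \<pi> \<noteq> [] \<and> last \<pi> = A \<and>
     (\<forall>i<length \<pi>.
        logical_axiom (\<pi> ! i) \<or> ZFC_axiom (\<pi> ! i) \<or> \<pi> ! i \<in> fst T \<or>
        (\<exists>j<i. \<exists>k<i. \<pi> ! j = (\<pi> ! k \<^bold>\<longrightarrow> \<pi> ! i)) \<or>
        (\<exists>j<i. \<exists>x. \<pi> ! i = Forall x (\<pi> ! j)))"

definition ZFC_provable :: "fm \<Rightarrow> bool" where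
  "ZFC_provable A \<longleftrightarrow> (\<exists>\<pi>. proves ({}, \<lambda>_. False) \<pi> A)"

definition ZFC_independent :: "fm \<Rightarrow> bool" where
  "ZFC_independent A \<longleftrightarrow> \<not> ZFC_provable A \<and> \<not> ZFC_provable (\<^bold>\<not> A)"


section \<open>Formalization of computations\<close>

fun sym_code :: "sym \<Rightarrow> nat" where
  "sym_code Zero = 0"
| "sym_code One = 1"
| "sym_code Blank = 2"
| "sym_code LeftEnd = 3"

text \<open>\<open>t\<^sub>i\<^sub>,\<^sub>j = (a, q, h)\<close>, where \<open>t\<close> is a function of the pair \<open>(i, j)\<close>; first for arbitrary sets \<open>a, q, h\<close>,
  then for numerals.\<close>

definition entry :: "tm \<Rightarrow> tm \<Rightarrow> tm \<Rightarrow> tm \<Rightarrow> tm \<Rightarrow> tm \<Rightarrow> fm" where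
  "entry t i j a q h = ExF [t, i, j, a, q, h] (\<lambda>p. ExF [t, i, j, a, q, h, p] (\<lambda>c.
     is_pair p i j \<^bold>\<and> is_triple c a q h \<^bold>\<and> is_app t p c))"

definition cell :: "tm \<Rightarrow> tm \<Rightarrow> tm \<Rightarrow> sym \<Rightarrow> nat \<Rightarrow> nat \<Rightarrow> fm" where
  "cell t i j a q h = ExNum [t, i, j] (sym_code a) (\<lambda>x. ExNum [t, i, j, x] q (\<lambda>y.
     ExNum [t, i, j, x, y] h (\<lambda>z. entry t i j x y z)))"

definition cell_sym :: "tm \<Rightarrow> tm \<Rightarrow> tm \<Rightarrow> sym \<Rightarrow> fm" where
  "cell_sym t i j a = ExNum [t, i, j] (sym_code a) (\<lambda>x. ExF [t, i, j, x] (\<lambda>q.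
     ExF [t, i, j, x, q] (\<lambda>h. entry t i j x q h)))"

definition cell_state :: "tm \<Rightarrow> tm \<Rightarrow> tm \<Rightarrow> tm \<Rightarrow> fm" where
  "cell_state t i j q = ExF [t, i, j, q] (\<lambda>a. ExF [t, i, j, q, a] (\<lambda>h. entry t i j a q h))"

definition cell_head :: "tm \<Rightarrow> tm \<Rightarrow> tm \<Rightarrow> fm" where
  "cell_head t i j = ExNum [t, i, j] 1 (\<lambda>h. ExF [t, i, j, h] (\<lambda>a.
     ExF [t, i, j, h, a] (\<lambda>q. entry t i j a q h)))"


subsection \<open>Tables of a machine\<close>

definition state_list :: "turing_machine \<Rightarrow> nat list" where
  "state_list M = sorted_list_of_set (states M)"

definition sym_list :: "sym list" where
  "sym_list = [Zero, One, Blank, LeftEnd]"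

text \<open>\<open>t\<close> is a function from \<open>\<omega> \<times> \<omega>\<close> \dots\<close>

definition def_function :: "tm \<Rightarrow> fm" where
  "def_function t = (
     AllF [t] (\<lambda>z. z \<^bold>\<in> t \<^bold>\<longrightarrow> ExF [t, z] (\<lambda>i. ExF [t, z, i] (\<lambda>j. ExF [t, z, i, j] (\<lambda>p.
       ExF [t, z, i, j, p] (\<lambda>c. is_nat i \<^bold>\<and> is_nat j \<^bold>\<and> is_pair p i j \<^bold>\<and> is_pair z p c))))) \<^bold>\<and>
     AllF [t] (\<lambda>i. AllF [t, i] (\<lambda>j. is_nat i \<^bold>\<and> is_nat j \<^bold>\<longrightarrow> ExF [t, i, j] (\<lambda>p.
       is_pair p i j \<^bold>\<and> ExF [t, i, j, p] (\<lambda>c. is_app t p c \<^bold>\<and>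
         AllF [t, i, j, p, c] (\<lambda>d. is_app t p d \<^bold>\<longrightarrow> d \<^bold>= c))))))"

text \<open>\dots with values in \<open>\<Gamma> \<times> Q \<times> {0, 1}\<close>; the disjunction over all values ends in a falsum.\<close>

definition def_values :: "turing_machine \<Rightarrow> tm \<Rightarrow> fm" where
  "def_values M t = AllF [t] (\<lambda>i. AllF [t, i] (\<lambda>j. is_nat i \<^bold>\<and> is_nat j \<^bold>\<longrightarrow>
     foldr Dis [cell t i j a q h. a \<leftarrow> sym_list, q \<leftarrow> state_list M, h \<leftarrow> [0, 1]] (\<^bold>\<not> t \<^bold>= t)))"

definition def_left_end :: "tm \<Rightarrow> fm" where
  "def_left_end t = AllF [t] (\<lambda>i. is_nat i \<^bold>\<longrightarrow> ExNum [t, i] 0 (\<lambda>z. cell_sym t i z LeftEnd))"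

text \<open>All entries of a row record the same (current) state.\<close>

definition def_state :: "tm \<Rightarrow> fm" where
  "def_state t = AllF [t] (\<lambda>i. is_nat i \<^bold>\<longrightarrow> ExF [t, i] (\<lambda>q. AllF [t, i, q] (\<lambda>j.
     is_nat j \<^bold>\<longrightarrow> cell_state t i j q)))"

definition def_head :: "tm \<Rightarrow> fm" where
  "def_head t = AllF [t] (\<lambda>i. is_nat i \<^bold>\<longrightarrow> ExF [t, i] (\<lambda>j. is_nat j \<^bold>\<and> cell_head t i j \<^bold>\<and>
     AllF [t, i, j] (\<lambda>k. is_nat k \<^bold>\<and> cell_head t i k \<^bold>\<longrightarrow> k \<^bold>= j)))"

definition def_initial :: "tm \<Rightarrow> fm" where
  "def_initial t = ExNum [t] 0 (\<lambda>z. ExF [t, z] (\<lambda>m. is_nat m \<^bold>\<and> AllF [t, z, m] (\<lambda>j. is_nat j \<^bold>\<longrightarrow>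
     (j \<^bold>\<in> m \<^bold>\<longrightarrow> \<^bold>\<not> cell_sym t z j Blank) \<^bold>\<and> (\<^bold>\<not> j \<^bold>\<in> m \<^bold>\<longrightarrow> cell_sym t z j Blank))))"

text \<open>\<open>j'\<close> is the head position after a move from \<open>j\<close>.\<close>

fun is_move :: "dir \<Rightarrow> tm \<Rightarrow> tm \<Rightarrow> fm" where
  "is_move MoveL j' j = (is_succ j j' \<^bold>\<or> (is_empty j \<^bold>\<and> j' \<^bold>= j))"
| "is_move Stay j' j = (j' \<^bold>= j)"
| "is_move MoveR j' j = is_succ j' j"

text \<open>The effect of one step in state \<open>q\<close> with symbol \<open>a\<close> under the head: the head is at \<open>j\<close> in row \<open>i\<close>,
  the next row is \<open>i'\<close> with head position \<open>j'\<close>, and cells other than \<open>j\<close> keep their symbol.\<close>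

definition def_step :: "turing_machine \<Rightarrow> tm \<Rightarrow> nat \<Rightarrow> sym \<Rightarrow> fm" where
  "def_step M t q a = (let (q', a', d) = action M q a in
     AllF [t] (\<lambda>i. AllF [t, i] (\<lambda>j. AllF [t, i, j] (\<lambda>i'. AllF [t, i, j, i'] (\<lambda>j'.
       is_nat i \<^bold>\<and> is_nat j \<^bold>\<and> is_succ i' i \<^bold>\<and> is_nat j' \<^bold>\<and> is_move d j' j \<^bold>\<and> cell t i j a q 1 \<^bold>\<longrightarrow>
         cell_head t i' j' \<^bold>\<and>
         AllF [t, i, j, i', j'] (\<lambda>k. is_nat k \<^bold>\<longrightarrow>
           ExNum [t, i, j, i', j', k] q' (\<lambda>x. cell_state t i' k x)) \<^bold>\<and>
         (\<^bold>\<not> is_empty j \<^bold>\<longrightarrow> cell_sym t i' j a') \<^bold>\<and>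
         AllF [t, i, j, i', j'] (\<lambda>k. is_nat k \<^bold>\<and> \<^bold>\<not> k \<^bold>= j \<^bold>\<longrightarrow>
           foldr Con [cell_sym t i k b \<^bold>\<longrightarrow> cell_sym t i' k b. b \<leftarrow> sym_list] (t \<^bold>= t)))))))"

definition def_M :: "turing_machine \<Rightarrow> tm \<Rightarrow> fm list" where
  "def_M M t = [def_function t, def_values M t, def_left_end t, def_state t, def_head t,
     def_initial t] @ [def_step M t q a. q \<leftarrow> state_list M, a \<leftarrow> sym_list]"


subsection \<open>Normal proofs\<close>

definition input_blank :: "turing_machine \<Rightarrow> nat \<Rightarrow> tm \<Rightarrow> fm" where
  "input_blank M n t = AllF [t] (\<lambda>j. is_nat j \<^bold>\<and> ExNum [t, j] n (\<lambda>x. x \<^bold>\<in> j) \<^bold>\<longrightarrow>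
     ExNum [t, j] 0 (\<lambda>z. cell t z j Blank (start M) 0))"

definition input_cell :: "nat \<Rightarrow> tm \<Rightarrow> sym \<Rightarrow> nat \<Rightarrow> nat \<Rightarrow> fm" where
  "input_cell j t a q h = ExNum [t] 0 (\<lambda>z. ExNum [t, z] j (\<lambda>x. cell t z x a q h))"

definition input_fms :: "turing_machine \<Rightarrow> bitstring \<Rightarrow> tm \<Rightarrow> fm list" where
  "input_fms M s t = [input_blank M (length s) t, input_cell 0 t LeftEnd (start M) 1] @
     [input_cell (k + 1) t (bit_sym (s ! k)) (start M) 0. k \<leftarrow> [0..<length s]]"

definition T_list :: "turing_machine \<Rightarrow> bitstring \<Rightarrow> fm list" where
  "T_list M s = def_M M Tab @ input_fms M s Tab"

definition AL :: "turing_machine \<Rightarrow> bitstring \<Rightarrow> fm \<Rightarrow> bool" where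
  "AL M s A \<longleftrightarrow> list_ex (\<lambda>B. A = B) (T_list M s)"

text \<open>\<open>\<exists>i t\<^sub>i\<^sub>,\<^sub>1 = (v, q\<^sub>h\<^sub>a\<^sub>l\<^sub>t, 1)\<close>\<close>

definition outputs :: "turing_machine \<Rightarrow> tm \<Rightarrow> tm \<Rightarrow> fm" where
  "outputs M t v = ExF [t, v] (\<lambda>i. is_nat i \<^bold>\<and> ExNum [t, v, i] 1 (\<lambda>j.
     ExNum [t, v, i, j] (halt M) (\<lambda>q. ExNum [t, v, i, j, q] 1 (\<lambda>h. entry t i j v q h))))"

definition normal_proof :: "turing_machine \<Rightarrow> bitstring \<Rightarrow> sym \<Rightarrow> fm list \<Rightarrow> bool" where
  "normal_proof M s v \<pi> \<longleftrightarrow> proves (set (T_list M s), AL M s) \<pi>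
     (ExNum [Tab] (sym_code v) (\<lambda>x. outputs M Tab x))"

text \<open>The minimum over the empty set is \<open>\<infinity>\<close>.\<close>

definition FS :: "turing_machine \<Rightarrow> bitstring \<Rightarrow> sym \<Rightarrow> enat" where
  "FS M s v = (INF \<pi>\<in>{\<pi>. normal_proof M s v \<pi>}. enat (ascii_norm \<pi>))"


subsection \<open>Statements about the machine in the language of ZFC\<close>

text \<open>\<open>s\<close> is a binary string of length \<open>n\<close>, i.e. a function from \<open>n \<in> \<omega>\<close> to \<open>{0, 1}\<close>.\<close>

definition has_length :: "tm \<Rightarrow> tm \<Rightarrow> fm" where
  "has_length s n = (is_nat n \<^bold>\<and>
     AllF [s, n] (\<lambda>z. z \<^bold>\<in> s \<^bold>\<longrightarrow> ExF [s, n, z] (\<lambda>k. ExF [s, n, z, k] (\<lambda>b.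
       k \<^bold>\<in> n \<^bold>\<and> (is_num 0 b \<^bold>\<or> is_num 1 b) \<^bold>\<and> is_pair z k b))) \<^bold>\<and>
     AllF [s, n] (\<lambda>k. k \<^bold>\<in> n \<^bold>\<longrightarrow> ExF [s, n, k] (\<lambda>b. is_app s k b \<^bold>\<and>
       AllF [s, n, k, b] (\<lambda>c. is_app s k c \<^bold>\<longrightarrow> c \<^bold>= b))))"

definition is_string :: "tm \<Rightarrow> fm" where
  "is_string s = ExF [s] (\<lambda>n. has_length s n)"

definition same_length :: "tm \<Rightarrow> tm \<Rightarrow> fm" where
  "same_length s r = ExF [s, r] (\<lambda>n. has_length s n \<^bold>\<and> has_length r n)"

definition longer :: "tm \<Rightarrow> tm \<Rightarrow> fm" where
  "longer s r = ExF [s, r] (\<lambda>n. ExF [s, r, n] (\<lambda>m. has_length s n \<^bold>\<and> has_length r m \<^bold>\<and> m \<^bold>\<in> n))"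

definition AllStr :: "tm list \<Rightarrow> (tm \<Rightarrow> fm) \<Rightarrow> fm" where
  "AllStr ts P = AllF ts (\<lambda>s. is_string s \<^bold>\<longrightarrow> P s)"

text \<open>The initial row of \<open>t\<close> is the one for input \<open>s\<close>; cf. \<open>input_fms\<close>, which is the external
  counterpart for a concrete string.\<close>

definition has_input :: "turing_machine \<Rightarrow> tm \<Rightarrow> tm \<Rightarrow> fm" where
  "has_input M t s = ExF [t, s] (\<lambda>n. has_length s n \<^bold>\<and> ExNum [t, s, n] 0 (\<lambda>z.
     AllF [t, s, n, z] (\<lambda>j. is_nat j \<^bold>\<and> n \<^bold>\<in> j \<^bold>\<longrightarrow> cell t z j Blank (start M) 0) \<^bold>\<and>
     cell t z z LeftEnd (start M) 1 \<^bold>\<and>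
     AllF [t, s, n, z] (\<lambda>k. AllF [t, s, n, z, k] (\<lambda>j. AllF [t, s, n, z, k, j] (\<lambda>b.
       k \<^bold>\<in> n \<^bold>\<and> is_succ j k \<^bold>\<and> is_app s k b \<^bold>\<longrightarrow>
         ExNum [t, s, n, z, k, j, b] (start M) (\<lambda>q. ExNum [t, s, n, z, k, j, b, q] 0 (\<lambda>h.
           entry t z j b q h)))))))"

text \<open>\<open>M(s) = v\<close>: some table of \<open>M\<close> on \<open>s\<close> has output \<open>v\<close>.\<close>

definition computes :: "turing_machine \<Rightarrow> tm \<Rightarrow> tm \<Rightarrow> fm" where
  "computes M s v = ExF [s, v] (\<lambda>t.
     foldr Con (def_M M t) (has_input M t s) \<^bold>\<and> outputs M t v)"

definition computes_sym :: "turing_machine \<Rightarrow> tm \<Rightarrow> sym \<Rightarrow> fm" where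
  "computes_sym M s v = ExNum [s] (sym_code v) (\<lambda>x. computes M s x)"

definition same_value :: "turing_machine \<Rightarrow> tm \<Rightarrow> tm \<Rightarrow> fm" where
  "same_value M s r = ExF [s, r] (\<lambda>v. computes M s v \<^bold>\<and> computes M r v)"

definition fm_length_only :: "turing_machine \<Rightarrow> fm" where
  "fm_length_only M = AllStr [] (\<lambda>r. AllStr [r] (\<lambda>s. same_length s r \<^bold>\<longrightarrow> same_value M s r))"

definition fm_one_downward :: "turing_machine \<Rightarrow> fm" where
  "fm_one_downward M = AllStr [] (\<lambda>r. AllStr [r] (\<lambda>s. longer s r \<^bold>\<longrightarrow>
     (computes_sym M s One \<^bold>\<longrightarrow> computes_sym M r One)))"

definition fm_zero_upward :: "turing_machine \<Rightarrow> fm" where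
  "fm_zero_upward M = AllStr [] (\<lambda>r. AllStr [r] (\<lambda>s. longer s r \<^bold>\<longrightarrow>
     (computes_sym M r Zero \<^bold>\<longrightarrow> computes_sym M s Zero)))"

definition fm_zero_or_one :: "turing_machine \<Rightarrow> fm" where
  "fm_zero_or_one M = AllStr [] (\<lambda>s. computes_sym M s Zero \<^bold>\<or> computes_sym M s One)"

definition fm_all_one :: "turing_machine \<Rightarrow> fm" where
  "fm_all_one M = AllStr [] (\<lambda>s. computes_sym M s One)"

definition fm_threshold :: "turing_machine \<Rightarrow> fm" where
  "fm_threshold M = (fm_all_one M \<^bold>\<or> ExF [] (\<lambda>m. is_nat m \<^bold>\<and> AllStr [m] (\<lambda>s.
     (ExF [m, s] (\<lambda>n. has_length s n \<^bold>\<and> n \<^bold>\<in> m) \<^bold>\<longrightarrow> computes_sym M s One) \<^bold>\<and>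
     (ExF [m, s] (\<lambda>n. has_length s n \<^bold>\<and> (m \<^bold>\<in> n \<^bold>\<or> m \<^bold>= n)) \<^bold>\<longrightarrow> computes_sym M s Zero))))"

end

theory Submission
  imports Defs "HOL-Library.Countable"
begin

text \<open>Suppose that all \<open>FS M s One\<close> are at most \<open>m\<close> and let \<open>s\<close> consist of \<open>m\<close> ones.  A normal proof
  for \<open>s\<close> of norm at most \<open>m\<close> is too short to contain the formula \<open>input_blank M m Tab\<close>, whose
  quantifier depth exceeds \<open>m\<close>.  So it only uses that the input starts with \<open>m\<close> ones, and by
  soundness ZFC knows that \<open>M\<close> outputs \<open>1\<close> on every string with this property.  For every \<open>r\<close> there
  is such a string longer than \<open>r\<close>; on it \<open>M\<close> has a computation table since \<open>M\<close> is total, and hence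
  \<open>M(r) = 1\<close> by downward monotonicity.  Thus ZFC proves \<open>\<forall>s (M(s) = 1)\<close>, contradicting independence.
  The argument inside ZFC is carried out in an arbitrary model, by the completeness theorem.\<close>

section \<open>Semantics and soundness\<close>

fun val :: "'u \<Rightarrow> (nat \<Rightarrow> 'u) \<Rightarrow> tm \<Rightarrow> 'u" where
  "val T e (Var x) = e x"
| "val T e Tab = T"

text \<open>The carrier \<open>D\<close> is a set rather than a type, because the term model is a quotient.\<close>

fun sat :: "'u set \<Rightarrow> ('u \<Rightarrow> 'u \<Rightarrow> bool) \<Rightarrow> 'u \<Rightarrow> (nat \<Rightarrow> 'u) \<Rightarrow> fm \<Rightarrow> bool" where
  "sat D E T e (Eq a b) \<longleftrightarrow> val T e a = val T e b"
| "sat D E T e (Mem a b) \<longleftrightarrow> E (val T e a) (val T e b)"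
| "sat D E T e (Neg A) \<longleftrightarrow> \<not> sat D E T e A"
| "sat D E T e (Imp A B) \<longleftrightarrow> (sat D E T e A \<longrightarrow> sat D E T e B)"
| "sat D E T e (Forall x A) \<longleftrightarrow> (\<forall>d\<in>D. sat D E T (e(x := d)) A)"

lemma finite_fv_tm [simp]: "finite (fv_tm u)"
  by (cases u) auto

lemma finite_all_vars [simp]: "finite (all_vars A)"
  by (induction A) auto

lemma fv_subset_all_vars: "fv A \<subseteq> all_vars A"
  by (induction A) auto

lemma val_cong: "(\<And>x. x \<in> fv_tm u \<Longrightarrow> e x = e' x) \<Longrightarrow> val T e u = val T e' u"
  by (cases u) auto

lemma sat_cong:
  "(\<And>x. x \<in> fv A \<Longrightarrow> e x = e' x) \<Longrightarrow> sat D E T e A \<longleftrightarrow> sat D E T e' A"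
proof (induction A arbitrary: e e')
  case (Eq a b)
  then show ?case using val_cong[of a e e' T] val_cong[of b e e' T] by auto
next
  case (Mem a b)
  then show ?case using val_cong[of a e e' T] val_cong[of b e e' T] by auto
next
  case (Neg A)
  show ?case using Neg.IH[OF Neg.prems] by simp
next
  case (Imp A B)
  have "sat D E T e A \<longleftrightarrow> sat D E T e' A" "sat D E T e B \<longleftrightarrow> sat D E T e' B"
    by (rule Imp.IH; use Imp.prems in simp)+
  then show ?case by simp
next
  case (Forall x A)
  have "sat D E T (e(x := d)) A \<longleftrightarrow> sat D E T (e'(x := d)) A" for d
    by (rule Forall.IH) (use Forall.prems in auto)
  then show ?case by simp
qed

text \<open>A formula without \<open>Tab\<close> does not see the element interpreting it; this
  later allows \<open>Tab\<close> to be reinterpreted within one model.\<close>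

lemma sat_pure: "pure A \<Longrightarrow> sat D E T e A \<longleftrightarrow> sat D E T' e A"
proof (induction A arbitrary: e)
  case (Eq a b)
  then show ?case by (cases a; cases b) auto
next
  case (Mem a b)
  then show ?case by (cases a; cases b) auto
qed auto

section \<open>The substitution lemma\<close>

lemma val_subst_tm: "val T e (subst_tm x u w) = val T (e(x := val T e u)) w"
  by (cases w) auto

lemma subst_tm_fresh: "x \<notin> fv_tm w \<Longrightarrow> subst_tm x u w = w"
  by (cases w) auto

lemma subst_fresh: "x \<notin> fv A \<Longrightarrow> subst x u A = A"
  by (induction A) (auto simp: subst_tm_fresh)

text \<open>In the quantifier case either \<open>x\<close> is not free and nothing is substituted,
  or \<open>free_for\<close> keeps \<open>y\<close> out of \<open>u\<close>, so that rebinding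
  \<open>y\<close> preserves the value of \<open>u\<close> and the two updates commute.\<close>

lemma sat_subst:
  "free_for u x A \<Longrightarrow> sat D E T e (subst x u A) \<longleftrightarrow> sat D E T (e(x := val T e u)) A"
proof (induction A arbitrary: e)
  case (Forall y A)
  show ?case
  proof (cases "x \<in> fv (Forall y A)")
    case True
    then have xy: "y \<noteq> x" and y: "y \<notin> fv_tm u" and ff: "free_for u x A"
      using Forall.prems by auto
    have "val T (e(y := d)) u = val T e u" for d
      using y by (intro val_cong) auto
    then have "sat D E T (e(y := d)) (subst x u A) \<longleftrightarrow> sat D E T (e(x := val T e u, y := d)) A" for d
      unfolding Forall.IH[OF ff] by (simp only: fun_upd_twist[OF xy])
    then show ?thesis using xy by (simp del: fun_upd_apply)
  next
    case False
    then have "sat D E T (e(x := val T e u)) (Forall y A) \<longleftrightarrow> sat D E T e (Forall y A)"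
      by (intro sat_cong) auto
    then show ?thesis using subst_fresh[OF False] by (simp del: fun_upd_apply)
  qed
qed (auto simp: val_subst_tm)

lemma free_for_Var_notin_all_vars: "y \<notin> all_vars A \<Longrightarrow> free_for (Var y) x A"
  by (induction A) auto

text \<open>Satisfaction is itself a valuation of the propositional atoms, whence tautologies are
  valid.\<close>

lemma sat_peval: "peval (sat D E T e) A \<longleftrightarrow> sat D E T e A"
  by (induction A) auto

lemma val_in: "T \<in> D \<Longrightarrow> (\<And>x. e x \<in> D) \<Longrightarrow> val T e u \<in> D"
  by (cases u) auto

section \<open>Soundness of the calculus\<close>

lemma logical_axiom_sat:
  assumes "logical_axiom A" "T \<in> D" "\<And>x. e x \<in> D"
  shows "sat D E T e A"
  using assms(1)
proof cases
  case taut
  then show ?thesis unfolding tautology_def by (metis sat_peval)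
next
  case (inst u x B)
  then show ?thesis using val_in[OF assms(2,3)] by (simp add: sat_subst)
next
  case (distr x B C)
  have "sat D E T (e(x := d)) B \<longleftrightarrow> sat D E T e B" for d
    using distr(2) by (intro sat_cong) auto
  then show ?thesis using distr by simp
next
  case (eq_refl u)
  then show ?thesis by simp
next
  case (eq_subst u x B v)
  then show ?thesis by (simp add: sat_subst)
qed

text \<open>Members of \<open>Th\<close> have to be true only if they occur in the proof, so a proof
  stays valid in structures that violate axioms it does not contain. Truth is carried along for all
  assignments because of generalization.\<close>

lemma proves_sat:
  assumes "proves (Th, al) \<pi> A"
    and ax: "\<And>B e. ZFC_axiom B \<Longrightarrow> (\<And>x. e x \<in> D) \<Longrightarrow> sat D E T e B"
    and th: "\<And>B e. B \<in> Th \<Longrightarrow> B \<in> set \<pi> \<Longrightarrow> (\<And>x. e x \<in> D) \<Longrightarrow> sat D E T e B"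
    and T: "T \<in> D" and e: "\<And>x. e x \<in> D"
  shows "sat D E T e A"
proof -
  have "\<forall>e. (\<forall>x. e x \<in> D) \<longrightarrow> sat D E T e (\<pi> ! i)" if "i < length \<pi>" for i
    using that
  proof (induction i rule: less_induct)
    case (less i)
    let ?B = "\<pi> ! i"
    have in_\<pi>: "?B \<in> set \<pi>" using less.prems by simp
    consider "logical_axiom ?B" | "ZFC_axiom ?B" | "?B \<in> Th"
      | j k where "j < i" "k < i" "\<pi> ! j = (\<pi> ! k \<^bold>\<longrightarrow> ?B)"
      | j x where "j < i" "?B = Forall x (\<pi> ! j)"
      using assms(1) less.prems unfolding proves_def by auto
    then show ?case
    proof cases
      case 4
      then have "\<forall>e. (\<forall>x. e x \<in> D) \<longrightarrow> sat D E T e (\<pi> ! j)"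
        and "\<forall>e. (\<forall>x. e x \<in> D) \<longrightarrow> sat D E T e (\<pi> ! k)"
        using less.IH less.prems by (meson less_trans)+
      then show ?thesis using 4(3) by auto
    next
      case 5
      then have "\<forall>e. (\<forall>x. e x \<in> D) \<longrightarrow> sat D E T e (\<pi> ! j)"
        using less.IH less.prems by (meson less_trans)
      then show ?thesis using 5(2) by simp
    qed (use logical_axiom_sat[OF _ T] ax th in_\<pi> in auto)
  qed
  moreover have "A = \<pi> ! (length \<pi> - 1)" "length \<pi> - 1 < length \<pi>"
    using assms(1) by (auto simp: proves_def last_conv_nth)
  ultimately show ?thesis using e by blast
qed

section \<open>Derivability in ZFC\<close>

lemma ZFC_provable_logical: "logical_axiom A \<Longrightarrow> ZFC_provable A"
  unfolding ZFC_provable_def proves_def by (intro exI[of _ "[A]"]) simp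

lemma ZFC_provable_axiom: "ZFC_axiom A \<Longrightarrow> ZFC_provable A"
  unfolding ZFC_provable_def proves_def by (intro exI[of _ "[A]"]) simp

text \<open>\<open>proves\<close> refers to positions, which shift under concatenation; membership
  in the earlier part does not, so derivations can be joined.\<close>

inductive ZFC_derivation :: "fm list \<Rightarrow> bool" where
  Nil: "ZFC_derivation []"
| axiom: "ZFC_derivation \<pi> \<Longrightarrow> logical_axiom A \<or> ZFC_axiom A \<Longrightarrow> ZFC_derivation (\<pi> @ [A])"
| mp: "ZFC_derivation \<pi> \<Longrightarrow> (B \<^bold>\<longrightarrow> A) \<in> set \<pi> \<Longrightarrow> B \<in> set \<pi> \<Longrightarrow> ZFC_derivation (\<pi> @ [A])"
| gen: "ZFC_derivation \<pi> \<Longrightarrow> A \<in> set \<pi> \<Longrightarrow> ZFC_derivation (\<pi> @ [Forall x A])"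

lemma ZFC_derivation_append:
  assumes "ZFC_derivation \<pi>"
  shows "ZFC_derivation \<rho> \<Longrightarrow> ZFC_derivation (\<pi> @ \<rho>)"
proof (induction \<rho> rule: ZFC_derivation.induct)
  case (axiom \<rho> A)
  then show ?case using ZFC_derivation.axiom[of "\<pi> @ \<rho>"] by simp
next
  case (mp \<rho> B A)
  then show ?case using ZFC_derivation.mp[of "\<pi> @ \<rho>" B] by simp
next
  case (gen \<rho> A x)
  then show ?case using ZFC_derivation.gen[of "\<pi> @ \<rho>"] by simp
qed (simp add: assms)

lemma ZFC_derivation_nth:
  "ZFC_derivation \<pi> \<Longrightarrow> \<forall>i<length \<pi>. logical_axiom (\<pi> ! i) \<or> ZFC_axiom (\<pi> ! i) \<or>
     (\<exists>j<i. \<exists>k<i. \<pi> ! j = (\<pi> ! k \<^bold>\<longrightarrow> \<pi> ! i)) \<or> (\<exists>j<i. \<exists>x. \<pi> ! i = Forall x (\<pi> ! j))"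
  (is "_ \<Longrightarrow> \<forall>i<length \<pi>. ?ok \<pi> i")
proof (induction rule: ZFC_derivation.induct)
  case Nil
  show ?case by simp
next
  case (axiom \<pi> A)
  have "?ok (\<pi> @ [A]) i" if "i < length \<pi>" for i
    using axiom.IH that by (simp add: nth_append cong: conj_cong)
  moreover have "?ok (\<pi> @ [A]) (length \<pi>)" using axiom by auto
  ultimately show ?case by (simp add: less_Suc_eq)
next
  case (mp \<pi> B A)
  obtain j k where "j < length \<pi>" "\<pi> ! j = (B \<^bold>\<longrightarrow> A)" "k < length \<pi>" "\<pi> ! k = B"
    using mp.hyps by (auto simp: in_set_conv_nth)
  then have "?ok (\<pi> @ [A]) (length \<pi>)" by (auto simp: nth_append)
  moreover have "?ok (\<pi> @ [A]) i" if "i < length \<pi>" for i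
    using mp.IH that by (simp add: nth_append cong: conj_cong)
  ultimately show ?case by (simp add: less_Suc_eq)
next
  case (gen \<pi> A x)
  obtain j where "j < length \<pi>" "\<pi> ! j = A"
    using gen.hyps by (auto simp: in_set_conv_nth)
  then have "?ok (\<pi> @ [Forall x A]) (length \<pi>)" by (auto simp: nth_append)
  moreover have "?ok (\<pi> @ [Forall x A]) i" if "i < length \<pi>" for i
    using gen.IH that by (simp add: nth_append cong: conj_cong)
  ultimately show ?case by (simp add: less_Suc_eq)
qed

lemma proves_ZFC_derivation:
  assumes "proves ({}, al) \<pi> A"
  shows "i \<le> length \<pi> \<Longrightarrow> ZFC_derivation (take i \<pi>)"
proof (induction i)
  case (Suc i)
  have prev: "\<pi> ! j \<in> set (take i \<pi>)" if "j < i" for j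
    using that Suc.prems by (auto simp: in_set_conv_nth)
  have "logical_axiom (\<pi> ! i) \<or> ZFC_axiom (\<pi> ! i) \<or>
     (\<exists>j<i. \<exists>k<i. \<pi> ! j = (\<pi> ! k \<^bold>\<longrightarrow> \<pi> ! i)) \<or> (\<exists>j<i. \<exists>x. \<pi> ! i = Forall x (\<pi> ! j))"
    using assms Suc.prems by (simp add: proves_def)
  moreover have "ZFC_derivation (take i \<pi>)" using Suc by simp
  ultimately have "ZFC_derivation (take i \<pi> @ [\<pi> ! i])"
    using prev ZFC_derivation.intros(2-4)[of "take i \<pi>"] by metis
  then show ?case using Suc.prems by (simp add: take_Suc_conv_app_nth)
qed (simp add: ZFC_derivation.Nil)

lemma ZFC_provable_iff: "ZFC_provable A \<longleftrightarrow> (\<exists>\<pi>. ZFC_derivation (\<pi> @ [A]))"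
proof
  assume "ZFC_provable A"
  then obtain \<pi> where \<pi>: "proves ({}, \<lambda>_. False) \<pi> A" unfolding ZFC_provable_def by blast
  then have "\<pi> = butlast \<pi> @ [A]" by (auto simp: proves_def)
  then show "\<exists>\<pi>. ZFC_derivation (\<pi> @ [A])"
    using proves_ZFC_derivation[OF \<pi>, of "length \<pi>"] by (metis order_refl take_all)
next
  assume "\<exists>\<pi>. ZFC_derivation (\<pi> @ [A])"
  then obtain \<pi> where "ZFC_derivation (\<pi> @ [A])" by blast
  from ZFC_derivation_nth[OF this] have "proves ({}, \<lambda>_. False) (\<pi> @ [A]) A"
    by (simp add: proves_def)
  then show "ZFC_provable A" unfolding ZFC_provable_def by blast
qed

lemma ZFC_provable_mp:
  assumes "ZFC_provable (A \<^bold>\<longrightarrow> B)" "ZFC_provable A"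
  shows "ZFC_provable B"
proof -
  obtain \<pi> \<rho> where "ZFC_derivation (\<pi> @ [A \<^bold>\<longrightarrow> B])" "ZFC_derivation (\<rho> @ [A])"
    using assms unfolding ZFC_provable_iff by blast
  then have "ZFC_derivation ((\<pi> @ [A \<^bold>\<longrightarrow> B]) @ (\<rho> @ [A]))" by (rule ZFC_derivation_append)
  then have "ZFC_derivation (((\<pi> @ [A \<^bold>\<longrightarrow> B]) @ (\<rho> @ [A])) @ [B])"
    by (rule ZFC_derivation.mp[of _ A]) auto
  then show ?thesis unfolding ZFC_provable_iff by blast
qed

lemma ZFC_provable_gen:
  assumes "ZFC_provable A"
  shows "ZFC_provable (Forall x A)"
proof -
  obtain \<pi> where "ZFC_derivation (\<pi> @ [A])"
    using assms unfolding ZFC_provable_iff by blast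
  then have "ZFC_derivation ((\<pi> @ [A]) @ [Forall x A])"
    by (rule ZFC_derivation.gen) auto
  then show ?thesis unfolding ZFC_provable_iff by blast
qed

text \<open>From here on propositional reasoning is semantic: every tautology is an axiom, so a
  check of all valuations replaces a derivation.\<close>

lemma ZFC_provable_taut: "(\<And>v. peval v A) \<Longrightarrow> ZFC_provable A"
  by (intro ZFC_provable_logical taut) (simp add: tautology_def)

lemma ZFC_provable_taut1:
  assumes "ZFC_provable A" "\<And>v. peval v A \<Longrightarrow> peval v B"
  shows "ZFC_provable B"
  by (rule ZFC_provable_mp[OF ZFC_provable_taut assms(1)]) (simp add: assms(2))

lemma ZFC_provable_taut2:
  assumes "ZFC_provable A" "ZFC_provable B" "\<And>v. peval v A \<Longrightarrow> peval v B \<Longrightarrow> peval v C"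
  shows "ZFC_provable C"
  by (rule ZFC_provable_mp[OF ZFC_provable_mp[OF ZFC_provable_taut assms(1)] assms(2)])
    (simp add: assms(3))

text \<open>The last conjunct has to be true under every propositional valuation, which the atom
  \<open>Eq Tab Tab\<close> alone is not; \<open>Tab\<close> keeps it free of variables.\<close>

definition conjoin :: "fm list \<Rightarrow> fm" where
  "conjoin L = foldr Con L (Imp (Eq Tab Tab) (Eq Tab Tab))"

lemma peval_conjoin [simp]: "peval v (conjoin L) \<longleftrightarrow> (\<forall>A\<in>set L. peval v A)"
  unfolding conjoin_def by (induction L) (auto simp: Con_def)

lemma fv_conjoin: "fv (conjoin L) = (\<Union>A\<in>set L. fv A)"
  unfolding conjoin_def by (induction L) (auto simp: Con_def)

text \<open>Stating consistency with ZFC through provability of one formula avoids a deduction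
  theorem for derivations from hypotheses.\<close>

definition consistent :: "fm list \<Rightarrow> bool" where
  "consistent L \<longleftrightarrow> \<not> ZFC_provable (Neg (conjoin L))"

lemma consistent_mono: "consistent L' \<Longrightarrow> set L \<subseteq> set L' \<Longrightarrow> consistent L"
  unfolding consistent_def by (erule contrapos_nn, erule ZFC_provable_taut1) auto

section \<open>Renaming of bound variables and fresh witnesses\<close>

lemma subst_subst_back:
  "y \<notin> all_vars A \<Longrightarrow> subst y (Var x) (subst x (Var y) A) = A"
proof (induction A)
  case (Eq a b)
  then show ?case by (cases a; cases b) auto
next
  case (Mem a b)
  then show ?case by (cases a; cases b) auto
next
  case (Forall z A)
  then show ?case using fv_subset_all_vars[of A] by (auto intro: subst_fresh)
qed auto

lemma fv_tm_subst: "fv_tm (subst_tm x u w) \<subseteq> fv_tm w - {x} \<union> fv_tm u"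
  by (cases w) auto

lemma fv_subst: "fv (subst x u A) \<subseteq> fv A - {x} \<union> fv_tm u"
proof (induction A)
  case (Eq a b)
  then show ?case using fv_tm_subst[of x u a] fv_tm_subst[of x u b] by auto
next
  case (Mem a b)
  then show ?case using fv_tm_subst[of x u a] fv_tm_subst[of x u b] by auto
qed auto

lemma free_for_subst_back:
  "y \<notin> all_vars A \<Longrightarrow> free_for (Var x) y (subst x (Var y) A)"
proof (induction A)
  case (Forall z A)
  then show ?case using fv_subset_all_vars[of A] fv_subst[of x "Var y" A] by auto
qed auto

text \<open>Instantiating \<open>y\<close> by \<open>x\<close> undoes the substitution and yields
  \<open>A\<close>; generalization over \<open>x\<close> and the distribution axiom restore the
  quantifier.\<close>

lemma ZFC_provable_rename:
  assumes "y \<notin> all_vars A"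
  shows "ZFC_provable (Forall y (subst x (Var y) A) \<^bold>\<longrightarrow> Forall x A)"
proof (cases "x = y")
  case True
  then have "subst x (Var y) A = A"
    using assms fv_subset_all_vars by (intro subst_fresh) blast
  then show ?thesis using True by (auto intro: ZFC_provable_taut)
next
  case False
  have "ZFC_provable (Forall y (subst x (Var y) A) \<^bold>\<longrightarrow> A)"
    using inst[OF free_for_subst_back[OF assms, of x]] subst_subst_back[OF assms, of x]
    by (auto intro: ZFC_provable_logical)
  from ZFC_provable_gen[OF this, of x] show ?thesis
    by (rule ZFC_provable_mp[rotated], intro ZFC_provable_logical distr)
      (use False fv_subst[of x "Var y" A] in auto)
qed

text \<open>Otherwise \<open>L\<close> proves the instance at \<open>y\<close>; as \<open>y\<close>
  does not occur in \<open>L\<close>, generalization and renaming give \<open>Forall x A\<close>,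
  whose negation belongs to \<open>L\<close>.\<close>

lemma consistent_witness:
  assumes "consistent L" "Neg (Forall x A) \<in> set L" "\<And>B. B \<in> set L \<Longrightarrow> y \<notin> all_vars B"
  shows "consistent (Neg (subst x (Var y) A) # L)"
proof (rule ccontr)
  assume "\<not> ?thesis"
  then have "ZFC_provable (conjoin L \<^bold>\<longrightarrow> subst x (Var y) A)"
    unfolding consistent_def by (simp, elim ZFC_provable_taut1) auto
  then have "ZFC_provable (Forall y (conjoin L \<^bold>\<longrightarrow> subst x (Var y) A))"
    by (rule ZFC_provable_gen)
  moreover have "y \<notin> fv (conjoin L)"
    using assms(3) fv_subset_all_vars by (fastforce simp: fv_conjoin)
  ultimately have "ZFC_provable (conjoin L \<^bold>\<longrightarrow> Forall y (subst x (Var y) A))"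
    using ZFC_provable_mp ZFC_provable_logical distr by blast
  moreover have "ZFC_provable (Forall y (subst x (Var y) A) \<^bold>\<longrightarrow> Forall x A)"
    using assms(2,3) by (intro ZFC_provable_rename) force
  ultimately have "ZFC_provable (Neg (conjoin L))"
  proof (rule ZFC_provable_taut2)
    fix v
    assume "peval v (conjoin L \<^bold>\<longrightarrow> Forall y (subst x (Var y) A))"
      "peval v (Forall y (subst x (Var y) A) \<^bold>\<longrightarrow> Forall x A)"
    then show "peval v (Neg (conjoin L))" using assms(2) by (metis peval.simps(1,2) peval_conjoin)
  qed
  then show False using assms(1) by (simp add: consistent_def)
qed

section \<open>Completeness\<close>

instance tm :: countable by countable_datatype
instance fm :: countable by countable_datatype

definition big_var :: "fm list \<Rightarrow> nat" where
  "big_var L = Suc (Max (insert 0 (\<Union>A\<in>set L. all_vars A)))"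

lemma big_var_greater: "A \<in> set L \<Longrightarrow> x \<in> all_vars A \<Longrightarrow> x < big_var L"
  unfolding big_var_def less_Suc_eq_le by (rule Max_ge) auto

text \<open>Variables serve as Henkin witnesses: only finitely many occur in \<open>A # L\<close>,
  so one beyond these is always available and no new constants have to be added.\<close>

definition witnesses :: "fm list \<Rightarrow> fm \<Rightarrow> fm list" where
  "witnesses L A = (case A of Neg (Forall x B) \<Rightarrow> [Neg (subst x (Var (big_var (A # L))) B)] | _ \<Rightarrow> [])"

text \<open>Lindenbaum construction along the enumeration \<open>from_nat\<close> of all formulas; a
  negated universal formula enters together with its witness.\<close>

primrec henkin :: "fm \<Rightarrow> nat \<Rightarrow> fm list" where
  "henkin F 0 = [F]"
| "henkin F (Suc n) = (let L = henkin F n; A = from_nat n in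
     if consistent (A # L) then witnesses L A @ A # L else L)"

definition henkin_set :: "fm \<Rightarrow> fm set" where
  "henkin_set F = (\<Union>n. set (henkin F n))"

lemma consistent_witnesses: "consistent (A # L) \<Longrightarrow> consistent (witnesses L A @ A # L)"
proof (cases "\<exists>x B. A = Neg (Forall x B)")
  case True
  then obtain x B where A: "A = Neg (Forall x B)" by blast
  assume "consistent (A # L)"
  then have "consistent (Neg (subst x (Var (big_var (A # L))) B) # A # L)"
    by (rule consistent_witness) (use A big_var_greater[of _ "A # L"] in auto)
  then show ?thesis by (simp add: witnesses_def A)
qed (auto simp: witnesses_def split: fm.splits)

locale henkin_theory =
  fixes F :: fm
  assumes F_consistent: "consistent [F]"
begin

abbreviation H :: "fm set" where "H \<equiv> henkin_set F"

lemma henkin_consistent: "consistent (henkin F n)"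
  by (induction n) (auto simp: Let_def F_consistent consistent_witnesses)

lemma henkin_mono: "m \<le> n \<Longrightarrow> set (henkin F m) \<subseteq> set (henkin F n)"
  by (rule lift_Suc_mono_le[of "\<lambda>n. set (henkin F n)"]) (auto simp: Let_def)

lemma finite_subset_stage:
  assumes "set L \<subseteq> H"
  obtains n where "set L \<subseteq> set (henkin F n)"
  using assms
proof (induction L arbitrary: thesis)
  case (Cons A L)
  obtain m where "set L \<subseteq> set (henkin F m)" using Cons by auto
  moreover obtain k where "A \<in> set (henkin F k)" using Cons by (auto simp: henkin_set_def)
  ultimately have "set (A # L) \<subseteq> set (henkin F (max k m))"
    using henkin_mono[of m "max k m"] henkin_mono[of k "max k m"] by auto
  then show ?case by (rule Cons.prems)
qed auto

lemma H_consistent: "set L \<subseteq> H \<Longrightarrow> consistent L"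
  by (metis finite_subset_stage consistent_mono henkin_consistent)

lemma H_stage: "set (henkin F n) \<subseteq> H"
  by (auto simp: henkin_set_def)

text \<open>A formula consistent with every finite part of \<open>H\<close> is in particular
  consistent with the stage at which its turn comes.\<close>

lemma H_added:
  assumes "\<And>L. set L \<subseteq> H \<Longrightarrow> consistent (A # L)"
  shows "A \<in> H" "set (witnesses (henkin F (to_nat A)) A) \<subseteq> H"
proof -
  have "henkin F (Suc (to_nat A)) = witnesses (henkin F (to_nat A)) A @ A # henkin F (to_nat A)"
    using assms[OF H_stage] by (simp add: Let_def)
  then show "A \<in> H" "set (witnesses (henkin F (to_nat A)) A) \<subseteq> H"
    using H_stage[of "Suc (to_nat A)"] by auto
qed

lemma H_closed:
  assumes "set L \<subseteq> H" "ZFC_provable (conjoin L \<^bold>\<longrightarrow> A)"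
  shows "A \<in> H"
proof (rule H_added(1))
  fix L' assume L': "set L' \<subseteq> H"
  show "consistent (A # L')"
    unfolding consistent_def
  proof
    assume "ZFC_provable (Neg (conjoin (A # L')))"
    with assms(2) have "ZFC_provable (Neg (conjoin (L @ L')))"
      by (rule ZFC_provable_taut2) auto
    moreover have "consistent (L @ L')" by (rule H_consistent) (use assms(1) L' in auto)
    ultimately show False by (simp add: consistent_def)
  qed
qed

lemma H_provable: "ZFC_provable A \<Longrightarrow> A \<in> H"
  by (rule H_closed[of "[]"]) (auto intro: ZFC_provable_taut1[of A])

lemma H_mp: "(A \<^bold>\<longrightarrow> B) \<in> H \<Longrightarrow> A \<in> H \<Longrightarrow> B \<in> H"
  by (rule H_closed[of "[A \<^bold>\<longrightarrow> B, A]"]) (auto intro: ZFC_provable_taut)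

lemma H_Neg: "Neg A \<in> H \<longleftrightarrow> A \<notin> H"
proof
  assume "Neg A \<in> H"
  moreover have "\<not> consistent [Neg A, A]"
    unfolding consistent_def by (auto intro: ZFC_provable_taut)
  ultimately show "A \<notin> H" using H_consistent[of "[Neg A, A]"] by auto
next
  assume "A \<notin> H"
  \<comment> \<open>Some finite part of \<open>H\<close> refutes \<open>A\<close> and hence proves
    \<open>Neg A\<close>.\<close>
  then obtain L where L: "set L \<subseteq> H" "\<not> consistent (A # L)" using H_added(1) by blast
  show "Neg A \<in> H"
    by (rule H_closed[OF L(1)])
      (rule ZFC_provable_taut1[of "Neg (conjoin (A # L))"], use L(2) in \<open>auto simp: consistent_def\<close>)
qed

lemma H_Imp: "(A \<^bold>\<longrightarrow> B) \<in> H \<longleftrightarrow> (A \<in> H \<longrightarrow> B \<in> H)"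
proof
  assume *: "A \<in> H \<longrightarrow> B \<in> H"
  show "(A \<^bold>\<longrightarrow> B) \<in> H"
  proof (cases "A \<in> H")
    case True
    then show ?thesis using * H_closed[of "[B]" "A \<^bold>\<longrightarrow> B"] ZFC_provable_taut by auto
  next
    case False
    then have "Neg A \<in> H" by (simp add: H_Neg)
    then show ?thesis using H_closed[of "[Neg A]" "A \<^bold>\<longrightarrow> B"] ZFC_provable_taut by auto
  qed
qed (auto intro: H_mp)

lemma H_witness:
  assumes "Neg (Forall x A) \<in> H"
  shows "\<exists>y. (\<forall>z\<in>all_vars (Forall x A). z < y) \<and> Neg (subst x (Var y) A) \<in> H"
proof -
  let ?B = "Neg (Forall x A)"
  let ?L = "henkin F (to_nat ?B)"
  have "set (witnesses ?L ?B) \<subseteq> H"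
    by (rule H_added(2)) (use H_consistent assms in auto)
  then show ?thesis
    using big_var_greater[of ?B "?B # ?L"] by (intro exI[of _ "big_var (?B # ?L)"]) (auto simp: witnesses_def)
qed

lemma H_inst: "Forall x A \<in> H \<Longrightarrow> free_for u x A \<Longrightarrow> subst x u A \<in> H"
  using H_mp H_provable[OF ZFC_provable_logical[OF inst]] by blast

lemma H_refl: "Eq u u \<in> H"
  by (intro H_provable ZFC_provable_logical eq_refl)

lemma H_eq_subst:
  "Eq u v \<in> H \<Longrightarrow> subst x u A \<in> H \<Longrightarrow> free_for u x A \<Longrightarrow> free_for v x A \<Longrightarrow> subst x v A \<in> H"
  using H_mp H_provable[OF ZFC_provable_logical[OF eq_subst]] by blast

lemma fresh_for: "\<exists>x. x \<notin> fv_tm u \<and> x \<notin> fv_tm v"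
  by (metis ex_new_if_finite finite_Un finite_fv_tm infinite_UNIV_nat UnCI)

text \<open>Leibniz's law for \<open>Eq (Var x) u\<close> turns \<open>Eq u u\<close> into
  \<open>Eq v u\<close>; freshness of \<open>x\<close> keeps the right-hand side fixed.\<close>

lemma H_sym: "Eq u v \<in> H \<Longrightarrow> Eq v u \<in> H"
proof -
  assume uv: "Eq u v \<in> H"
  obtain x where x: "x \<notin> fv_tm u" using fresh_for by blast
  show ?thesis
    using H_eq_subst[OF uv, of x "Eq (Var x) u"] x by (simp add: subst_tm_fresh H_refl)
qed

lemma H_trans: "Eq u v \<in> H \<Longrightarrow> Eq v w \<in> H \<Longrightarrow> Eq u w \<in> H"
proof -
  assume uv: "Eq u v \<in> H" and vw: "Eq v w \<in> H"
  obtain x where x: "x \<notin> fv_tm u" using fresh_for by blast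
  show ?thesis
    using H_eq_subst[OF vw, of x "Eq u (Var x)"] x uv by (simp add: subst_tm_fresh)
qed

lemma H_Mem:
  assumes "Eq u u' \<in> H" "Eq v v' \<in> H" "Mem u v \<in> H"
  shows "Mem u' v' \<in> H"
proof -
  obtain x y where x: "x \<notin> fv_tm v" and y: "y \<notin> fv_tm u'" using fresh_for by blast
  have "Mem u' v \<in> H"
    using H_eq_subst[OF assms(1), of x "Mem (Var x) v"] x assms(3) by (simp add: subst_tm_fresh)
  then show ?thesis
    using H_eq_subst[OF assms(2), of y "Mem u' (Var y)"] y by (simp add: subst_tm_fresh)
qed

text \<open>Every element of the term model is denoted by arbitrarily large variables, so that the
  truth lemma never has to rename bound variables.\<close>

lemma H_big_name: "\<exists>y>N. Eq (Var y) u \<in> H"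
proof -
  obtain x where x: "x \<notin> fv_tm u" "x \<noteq> N" using fresh_for[of u "Var N"] by auto
  \<comment> \<open>The instance at \<open>u\<close> refutes \<open>Forall x B\<close>, so some
    witness \<open>y\<close> satisfies \<open>Eq (Var y) u\<close>. The trivial equation puts
    \<open>N\<close> among the variables of the formula, which forces \<open>y > N\<close>.\<close>
  define B where "B = Neg (Imp (Eq (Var N) (Var N)) (Eq (Var x) u))"
  have "Forall x B \<notin> H"
  proof
    assume "Forall x B \<in> H"
    then have "subst x u B \<in> H" by (rule H_inst) (simp add: B_def)
    then show False using x by (simp add: B_def subst_tm_fresh H_Neg H_Imp H_refl)
  qed
  then obtain y where "\<forall>z\<in>all_vars (Forall x B). z < y" "Neg (subst x (Var y) B) \<in> H"
    using H_witness H_Neg by blast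
  then show ?thesis using x by (auto simp: B_def subst_tm_fresh H_Neg H_Imp H_refl)
qed

section \<open>The term model of equality classes\<close>

definition cls :: "tm \<Rightarrow> tm set" where
  "cls u = {v. Eq u v \<in> H}"

definition elem :: "tm set \<Rightarrow> tm set \<Rightarrow> bool" where
  "elem c d \<longleftrightarrow> (\<exists>u\<in>c. \<exists>v\<in>d. Mem u v \<in> H)"

abbreviation holds :: "(nat \<Rightarrow> tm set) \<Rightarrow> fm \<Rightarrow> bool" where
  "holds \<equiv> sat (range cls) elem (cls Tab)"

lemma cls_eq_iff: "cls u = cls v \<longleftrightarrow> Eq u v \<in> H"
  unfolding cls_def using H_refl H_sym H_trans by blast

lemma elem_iff: "elem (cls u) (cls v) \<longleftrightarrow> Mem u v \<in> H"
  unfolding elem_def cls_def using H_refl H_sym H_Mem by blast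

lemma val_cls: "val (cls Tab) (\<lambda>n. cls (Var n)) u = cls u"
  by (cases u) auto

lemma size_subst [simp]: "size (subst x u A) = size A"
  by (induction A) auto

text \<open>Induction on the size, since the quantifier case appeals to instances
  \<open>subst x (Var y) B\<close>, which are not subformulas but have the size of
  \<open>B\<close>.\<close>

lemma truth: "holds (\<lambda>n. cls (Var n)) A \<longleftrightarrow> A \<in> H"
proof (induction "size A" arbitrary: A rule: less_induct)
  case less
  show ?case
  proof (cases A)
    case (Forall x B)
    have inst_iff: "holds ((\<lambda>n. cls (Var n))(x := cls (Var y))) B \<longleftrightarrow> subst x (Var y) B \<in> H"
      if "y \<notin> all_vars B" for y
      using sat_subst[OF free_for_Var_notin_all_vars[OF that], where e = "\<lambda>n. cls (Var n)"]
        less[of "subst x (Var y) B"] Forall by (simp add: val_cls)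
    show ?thesis
    proof
      assume *: "holds (\<lambda>n. cls (Var n)) A"
      show "A \<in> H"
      proof (rule ccontr)
        assume "A \<notin> H"
        then obtain y where y: "\<forall>z\<in>all_vars (Forall x B). z < y" "Neg (subst x (Var y) B) \<in> H"
          using H_witness H_Neg Forall by blast
        then have "y \<notin> all_vars B" by auto
        then show False using * y(2) inst_iff Forall by (auto simp: H_Neg)
      qed
    next
      assume A: "A \<in> H"
      have "holds ((\<lambda>n. cls (Var n))(x := cls u)) B" for u
      proof -
        \<comment> \<open>The class of \<open>u\<close> has a name too large to occur in
          \<open>B\<close>, so substituting it causes no capture.\<close>
        obtain y where y: "y > Max (insert 0 (all_vars B))" "Eq (Var y) u \<in> H"
          using H_big_name by blast
        then have yB: "y \<notin> all_vars B" using Max_ge[of "insert 0 (all_vars B)" y] by auto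
        then have "subst x (Var y) B \<in> H"
          using A H_inst free_for_Var_notin_all_vars Forall by blast
        then show ?thesis using inst_iff[OF yB] y(2) by (simp add: cls_eq_iff[symmetric])
      qed
      then show "holds (\<lambda>n. cls (Var n)) A" using Forall by auto
    qed
  qed (use less in \<open>auto simp: val_cls cls_eq_iff elem_iff H_Neg H_Imp\<close>)
qed

end

lemma sat_foldr_Forall:
  assumes "sat D E T e (foldr Forall xs A)" "\<And>x. x \<notin> set xs \<Longrightarrow> e' x = e x" "\<And>x. e' x \<in> D"
  shows "sat D E T e' A"
  using assms
proof (induction xs arbitrary: e)
  case Nil
  then have "e' = e" by auto
  then show ?case using Nil by simp
next
  case (Cons x xs)
  have "sat D E T (e(x := e' x)) (foldr Forall xs A)"
    using Cons.prems(1,3) by (simp del: fun_upd_apply)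
  then show ?case by (rule Cons.IH) (use Cons.prems in auto)
qed

text \<open>The term model of a Henkin set containing \<open>Neg A\<close> is as required. Theorems
  hold in it under all assignments, not only the canonical one, since their universal closures are
  provable too.\<close>

theorem ZFC_completeness:
  assumes "\<not> ZFC_provable A"
  obtains D :: "tm set set" and E T e where "\<not> sat D E T e A" "T \<in> D" "\<And>x. e x \<in> D"
    "\<And>B e. ZFC_provable B \<Longrightarrow> (\<And>x. e x \<in> D) \<Longrightarrow> sat D E T e B"
proof -
  interpret henkin_theory "Neg A"
    by unfold_locales
      (use assms ZFC_provable_taut1[of "Neg (conjoin [Neg A])" A] in \<open>auto simp: consistent_def\<close>)
  have "Neg A \<in> H" using H_stage[of 0] by auto
  then have not_A: "\<not> holds (\<lambda>n. cls (Var n)) A" by (simp add: truth H_Neg)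
  have valid: "holds e B" if B: "ZFC_provable B" and e: "\<And>x. e x \<in> range cls" for B e
  proof -
    obtain xs where xs: "set xs = fv B"
      using finite_list[of "fv B"] finite_subset[OF fv_subset_all_vars[of B]] by auto
    have "ZFC_provable (foldr Forall ys B)" for ys
      by (induction ys) (auto intro: B ZFC_provable_gen)
    then have "holds (\<lambda>n. cls (Var n)) (foldr Forall xs B)" by (simp add: truth H_provable)
    \<comment> \<open>Outside \<open>fv B\<close> the assignment has to agree with the canonical
      one, as the closure quantifies over \<open>xs\<close> only.\<close>
    then have "holds (\<lambda>x. if x \<in> fv B then e x else cls (Var x)) B"
      by (rule sat_foldr_Forall) (use e xs in auto)
    then show ?thesis by (subst sat_cong) auto
  qed
  show thesis by (rule that[OF not_A _ _ valid]) auto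
qed

section \<open>Length of formulas\<close>

text \<open>Depth rather than size: \<open>Iff\<close> duplicates its arguments, so the size of a
  formula may exceed the length of its shortest representation, while the quantifier depth never
  does.\<close>

fun qdepth :: "fm \<Rightarrow> nat" where
  "qdepth (Neg A) = qdepth A"
| "qdepth (Imp A B) = max (qdepth A) (qdepth B)"
| "qdepth (Forall x A) = Suc (qdepth A)"
| "qdepth _ = 0"

lemma qdepth_le_ascii: "ascii A w \<Longrightarrow> qdepth A \<le> length w"
  by (induction rule: ascii.induct)
    (auto simp: Con_def Dis_def Iff_def Exists_def ctrl_def)

lemma ascii_tm_total: "\<exists>w. ascii_tm u w"
  by (cases u) (auto intro: ascii_tm.intros)

lemma ascii_total: "\<exists>w. ascii A w"
proof (induction A)
  case (Eq a b)
  then show ?case using ascii_tm_total[of a] ascii_tm_total[of b] by (blast intro: ascii.intros)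
next
  case (Mem a b)
  then show ?case using ascii_tm_total[of a] ascii_tm_total[of b] by (blast intro: ascii.intros)
next
  case (Forall x A)
  then show ?case using ascii_tm_total[of "Var x"] by (blast intro: ascii.intros)
qed (blast intro: ascii.intros)+

lemma qdepth_le_asciilen: "qdepth A \<le> asciilen A"
proof -
  have "\<exists>n w. ascii A w \<and> length w = n" using ascii_total by blast
  then have "\<exists>w. ascii A w \<and> length w = asciilen A"
    unfolding asciilen_def by (rule LeastI_ex)
  then show ?thesis using qdepth_le_ascii by metis
qed

lemma asciilen_le_ascii_norm: "A \<in> set \<pi> \<Longrightarrow> asciilen A \<le> ascii_norm \<pi>"
  unfolding ascii_norm_def by (intro member_le_sum_list) auto

lemma qdepth_is_num: "n \<le> qdepth (is_num n a)"
  by (induction n arbitrary: a) (auto simp: ExF_def Exists_def Con_def le_max_iff_disj)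

text \<open>The numeral is spelled out by \<open>n\<close> nested quantifiers below the one for the
  cell; hence no formula list of norm at most \<open>n\<close> contains this axiom.\<close>

lemma qdepth_input_blank: "n < qdepth (input_blank M n t)"
  using qdepth_is_num[of n "Var (fresh [t, Var (fresh [t])])"]
  by (simp add: input_blank_def AllF_def ExNum_def ExF_def Exists_def Con_def le_max_iff_disj less_Suc_eq_le)

section \<open>Interpretation of the set-theoretic notions\<close>

declare val.simps [simp del]

lemma val_Tab [simp]: "val T e Tab = T"
  by (simp add: val.simps)

lemma val_Var_upd [simp]: "val T (e(x := d)) (Var x) = d"
  by (simp add: val.simps)

lemma fresh_notin: "u \<in> set ts \<Longrightarrow> fresh ts \<notin> fv_tm u"
proof
  assume "u \<in> set ts" "fresh ts \<in> fv_tm u"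
  then have "fresh ts \<le> Max (insert 0 (\<Union>u\<in>set ts. fv_tm u))"
    by (intro Max_ge) auto
  then show False by (simp add: fresh_def)
qed

text \<open>As \<open>ts\<close> lists the terms of the body, binding \<open>fresh ts\<close>
  preserves their values. This simplification rule evaluates formulas without computing any
  \<open>fresh ts\<close>.\<close>

lemma val_upd_fresh [simp]: "u \<in> set ts \<Longrightarrow> val T (e(fresh ts := d)) u = val T e u"
  using fresh_notin by (intro val_cong) auto

lemma sat_Con [simp]: "sat D E T e (Con A B) \<longleftrightarrow> sat D E T e A \<and> sat D E T e B"
  by (simp add: Con_def)

lemma sat_Dis [simp]: "sat D E T e (Dis A B) \<longleftrightarrow> sat D E T e A \<or> sat D E T e B"
  by (auto simp: Dis_def)

lemma sat_Iff [simp]: "sat D E T e (Iff A B) \<longleftrightarrow> (sat D E T e A \<longleftrightarrow> sat D E T e B)"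
  by (auto simp: Iff_def)

lemma sat_Exists [simp]: "sat D E T e (Exists x A) \<longleftrightarrow> (\<exists>d\<in>D. sat D E T (e(x := d)) A)"
  by (simp add: Exists_def)

lemma sat_AllF [simp]:
  "sat D E T e (AllF ts P) \<longleftrightarrow> (\<forall>d\<in>D. sat D E T (e(fresh ts := d)) (P (Var (fresh ts))))"
  by (simp add: AllF_def)

lemma sat_ExF [simp]:
  "sat D E T e (ExF ts P) \<longleftrightarrow> (\<exists>d\<in>D. sat D E T (e(fresh ts := d)) (P (Var (fresh ts))))"
  by (simp add: ExF_def)

lemma sat_foldr_Con: "sat D E T e (foldr Con L A) \<longleftrightarrow> (\<forall>B\<in>set L. sat D E T e B) \<and> sat D E T e A"
  by (induction L) auto

lemma sat_foldr_Dis: "sat D E T e (foldr Dis L A) \<longleftrightarrow> (\<exists>B\<in>set L. sat D E T e B) \<or> sat D E T e A"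
  by (induction L) auto

section \<open>Set-theoretic notions evaluated in a membership structure\<close>

locale membership_structure =
  fixes D :: "'u set" and E :: "'u \<Rightarrow> 'u \<Rightarrow> bool"
begin

definition mempty :: "'u \<Rightarrow> bool" where
  "mempty a \<longleftrightarrow> (\<forall>z\<in>D. \<not> E z a)"

definition msucc :: "'u \<Rightarrow> 'u \<Rightarrow> bool" where
  "msucc a b \<longleftrightarrow> (\<forall>z\<in>D. E z a \<longleftrightarrow> E z b \<or> z = b)"

definition mupair :: "'u \<Rightarrow> 'u \<Rightarrow> 'u \<Rightarrow> bool" where
  "mupair c a b \<longleftrightarrow> (\<forall>z\<in>D. E z c \<longleftrightarrow> z = a \<or> z = b)"

definition mpair :: "'u \<Rightarrow> 'u \<Rightarrow> 'u \<Rightarrow> bool" where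
  "mpair c a b \<longleftrightarrow> (\<exists>u\<in>D. \<exists>v\<in>D. mupair u a a \<and> mupair v a b \<and> mupair c u v)"

definition minductive :: "'u \<Rightarrow> bool" where
  "minductive w \<longleftrightarrow> (\<exists>z\<in>D. mempty z \<and> E z w) \<and>
     (\<forall>x\<in>D. E x w \<longrightarrow> (\<exists>y\<in>D. msucc y x \<and> E y w))"

definition mnat :: "'u \<Rightarrow> bool" where
  "mnat a \<longleftrightarrow> (\<forall>w\<in>D. minductive w \<longrightarrow> E a w)"

primrec mnum :: "nat \<Rightarrow> 'u \<Rightarrow> bool" where
  "mnum 0 a \<longleftrightarrow> mempty a"
| "mnum (Suc n) a \<longleftrightarrow> (\<exists>b\<in>D. mnum n b \<and> msucc a b)"

definition mapp :: "'u \<Rightarrow> 'u \<Rightarrow> 'u \<Rightarrow> bool" where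
  "mapp f a b \<longleftrightarrow> (\<exists>z\<in>D. mpair z a b \<and> E z f)"

definition mentry :: "'u \<Rightarrow> 'u \<Rightarrow> 'u \<Rightarrow> 'u \<Rightarrow> 'u \<Rightarrow> 'u \<Rightarrow> bool" where
  "mentry t i j a q h \<longleftrightarrow> (\<exists>p\<in>D. \<exists>c\<in>D. mpair p i j \<and>
     (\<exists>r\<in>D. mpair r a q \<and> mpair c r h) \<and> mapp t p c)"

definition mcell :: "'u \<Rightarrow> 'u \<Rightarrow> 'u \<Rightarrow> sym \<Rightarrow> nat \<Rightarrow> nat \<Rightarrow> bool" where
  "mcell t i j a q h \<longleftrightarrow> (\<exists>x\<in>D. mnum (sym_code a) x \<and> (\<exists>y\<in>D. mnum q y \<and>
     (\<exists>z\<in>D. mnum h z \<and> mentry t i j x y z)))"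

definition mlength :: "'u \<Rightarrow> 'u \<Rightarrow> bool" where
  "mlength s n \<longleftrightarrow> mnat n \<and>
     (\<forall>z\<in>D. E z s \<longrightarrow> (\<exists>k\<in>D. \<exists>b\<in>D. E k n \<and> (mnum 0 b \<or> mnum 1 b) \<and> mpair z k b)) \<and>
     (\<forall>k\<in>D. E k n \<longrightarrow> (\<exists>b\<in>D. mapp s k b \<and> (\<forall>c\<in>D. mapp s k c \<longrightarrow> c = b)))"

lemma sat_is_empty [simp]: "sat D E T e (is_empty a) \<longleftrightarrow> mempty (val T e a)"
  by (simp add: is_empty_def mempty_def)

lemma sat_is_succ [simp]: "sat D E T e (is_succ a b) \<longleftrightarrow> msucc (val T e a) (val T e b)"
  by (simp add: is_succ_def msucc_def)

lemma sat_is_upair [simp]: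
  "sat D E T e (is_upair c a b) \<longleftrightarrow> mupair (val T e c) (val T e a) (val T e b)"
  by (simp add: is_upair_def mupair_def)

lemma sat_is_pair [simp]:
  "sat D E T e (is_pair c a b) \<longleftrightarrow> mpair (val T e c) (val T e a) (val T e b)"
  by (simp add: is_pair_def mpair_def)

lemma sat_is_inductive [simp]: "sat D E T e (is_inductive w) \<longleftrightarrow> minductive (val T e w)"
  by (simp add: is_inductive_def minductive_def)

lemma sat_is_nat [simp]: "sat D E T e (is_nat a) \<longleftrightarrow> mnat (val T e a)"
  by (simp add: is_nat_def mnat_def)

lemma sat_is_num [simp]: "sat D E T e (is_num n a) \<longleftrightarrow> mnum n (val T e a)"
  by (induction n arbitrary: a e) simp_all

lemma sat_ExNum [simp]:
  "sat D E T e (ExNum ts n P) \<longleftrightarrow>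
     (\<exists>d\<in>D. mnum n d \<and> sat D E T (e(fresh ts := d)) (P (Var (fresh ts))))"
  by (simp add: ExNum_def)

lemma sat_is_app [simp]:
  "sat D E T e (is_app f a b) \<longleftrightarrow> mapp (val T e f) (val T e a) (val T e b)"
  by (simp add: is_app_def mapp_def)

lemma sat_entry [simp]:
  "sat D E T e (entry t i j a q h) \<longleftrightarrow>
     mentry (val T e t) (val T e i) (val T e j) (val T e a) (val T e q) (val T e h)"
  by (simp add: entry_def mentry_def is_triple_def)

lemma sat_cell [simp]:
  "sat D E T e (cell t i j a q h) \<longleftrightarrow> mcell (val T e t) (val T e i) (val T e j) a q h"
  by (simp add: cell_def mcell_def)

lemma sat_cell_sym [simp]:
  "sat D E T e (cell_sym t i j a) \<longleftrightarrow> (\<exists>x\<in>D. mnum (sym_code a) x \<and>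
     (\<exists>q\<in>D. \<exists>h\<in>D. mentry (val T e t) (val T e i) (val T e j) x q h))"
  by (simp add: cell_sym_def)

lemma sat_cell_state [simp]:
  "sat D E T e (cell_state t i j q) \<longleftrightarrow>
     (\<exists>a\<in>D. \<exists>h\<in>D. mentry (val T e t) (val T e i) (val T e j) a (val T e q) h)"
  by (simp add: cell_state_def)

lemma sat_cell_head [simp]:
  "sat D E T e (cell_head t i j) \<longleftrightarrow> (\<exists>h\<in>D. mnum 1 h \<and>
     (\<exists>a\<in>D. \<exists>q\<in>D. mentry (val T e t) (val T e i) (val T e j) a q h))"
  by (simp add: cell_head_def)

definition mmove :: "dir \<Rightarrow> 'u \<Rightarrow> 'u \<Rightarrow> bool" where
  "mmove d j' j \<longleftrightarrow> (case d of
     MoveL \<Rightarrow> msucc j j' \<or> mempty j \<and> j' = j | Stay \<Rightarrow> j' = j | MoveR \<Rightarrow> msucc j' j)"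

lemma sat_is_move [simp]: "sat D E T e (is_move d j' j) \<longleftrightarrow> mmove d (val T e j') (val T e j)"
  by (cases d) (simp_all add: mmove_def)

lemma sat_has_length [simp]:
  "sat D E T e (has_length s n) \<longleftrightarrow> mlength (val T e s) (val T e n)"
  by (simp add: has_length_def mlength_def)

text \<open>The bound variables of \<open>def_M M t\<close> depend on the term \<open>t\<close>, so \<open>def_M M Tab\<close> and \<open>def_M M (Var x)\<close>
  are not substitution instances of each other, but only semantically equivalent.\<close>

lemma sat_def_M_cong:
  assumes "val T e t = val T' e' t'"
  shows "(\<forall>A\<in>set (def_M M t). sat D E T e A) \<longleftrightarrow> (\<forall>A\<in>set (def_M M t'). sat D E T' e' A)"
proof -
  have "sat D E T e (def_function t) \<longleftrightarrow> sat D E T' e' (def_function t')"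
    by (simp add: def_function_def assms)
  moreover have "sat D E T e (def_values M t) \<longleftrightarrow> sat D E T' e' (def_values M t')"
    by (simp add: def_values_def sat_foldr_Dis assms)
  moreover have "sat D E T e (def_left_end t) \<longleftrightarrow> sat D E T' e' (def_left_end t')"
    by (simp add: def_left_end_def assms)
  moreover have "sat D E T e (def_state t) \<longleftrightarrow> sat D E T' e' (def_state t')"
    by (simp add: def_state_def assms)
  moreover have "sat D E T e (def_head t) \<longleftrightarrow> sat D E T' e' (def_head t')"
    by (simp add: def_head_def assms)
  moreover have "sat D E T e (def_initial t) \<longleftrightarrow> sat D E T' e' (def_initial t')"
    by (simp add: def_initial_def assms)
  moreover have "sat D E T e (def_step M t q a) \<longleftrightarrow> sat D E T' e' (def_step M t' q a)" for q a
    by (cases "action M q a") (simp add: def_step_def sat_foldr_Con assms)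
  ultimately show ?thesis by (simp add: def_M_def)
qed

lemma sat_input_cell [simp]:
  "sat D E T e (input_cell j t a q h) \<longleftrightarrow>
     (\<exists>z\<in>D. mnum 0 z \<and> (\<exists>x\<in>D. mnum j x \<and> mcell (val T e t) z x a q h))"
  by (simp add: input_cell_def)

definition moutputs :: "turing_machine \<Rightarrow> 'u \<Rightarrow> 'u \<Rightarrow> bool" where
  "moutputs M t v \<longleftrightarrow> (\<exists>i\<in>D. mnat i \<and> (\<exists>j\<in>D. mnum 1 j \<and> (\<exists>q\<in>D. mnum (halt M) q \<and>
     (\<exists>h\<in>D. mnum 1 h \<and> mentry t i j v q h))))"

lemma sat_outputs [simp]: "sat D E T e (outputs M t v) \<longleftrightarrow> moutputs M (val T e t) (val T e v)"
  by (simp add: outputs_def moutputs_def)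

definition minput :: "turing_machine \<Rightarrow> 'u \<Rightarrow> 'u \<Rightarrow> bool" where
  "minput M t s \<longleftrightarrow> (\<exists>n\<in>D. mlength s n \<and> (\<exists>z\<in>D. mnum 0 z \<and>
     (\<forall>j\<in>D. mnat j \<and> E n j \<longrightarrow> mcell t z j Blank (start M) 0) \<and>
     mcell t z z LeftEnd (start M) 1 \<and>
     (\<forall>k\<in>D. \<forall>j\<in>D. \<forall>b\<in>D. E k n \<and> msucc j k \<and> mapp s k b \<longrightarrow>
        (\<exists>q\<in>D. mnum (start M) q \<and> (\<exists>h\<in>D. mnum 0 h \<and> mentry t z j b q h)))))"

lemma sat_has_input [simp]: "sat D E T e (has_input M t s) \<longleftrightarrow> minput M (val T e t) (val T e s)"
  by (simp add: has_input_def minput_def)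

text \<open>Being a table is expressed by the formulas themselves, with \<open>t\<close>
  interpreting \<open>Tab\<close>: the property is only transferred between the bound variable in
  \<open>computes\<close> and \<open>Tab\<close> in \<open>T_list\<close>, never analysed.\<close>

definition mtable :: "turing_machine \<Rightarrow> 'u \<Rightarrow> bool" where
  "mtable M t \<longleftrightarrow> (\<forall>e. \<forall>A\<in>set (def_M M Tab). sat D E t e A)"

lemma sat_def_M: "(\<forall>A\<in>set (def_M M t). sat D E T e A) \<longleftrightarrow> mtable M (val T e t)"
  unfolding mtable_def using sat_def_M_cong[of T e t "val T e t" _ Tab] by simp

definition mcomputes :: "turing_machine \<Rightarrow> 'u \<Rightarrow> sym \<Rightarrow> bool" where
  "mcomputes M s v \<longleftrightarrow> (\<exists>x\<in>D. mnum (sym_code v) x \<and>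
     (\<exists>t\<in>D. mtable M t \<and> minput M t s \<and> moutputs M t x))"

lemma sat_computes_sym [simp]:
  "sat D E T e (computes_sym M s v) \<longleftrightarrow> mcomputes M (val T e s) v"
  by (simp add: computes_sym_def computes_def mcomputes_def sat_foldr_Con sat_def_M conj_assoc)

lemma sat_AllStr [simp]:
  "sat D E T e (AllStr ts P) \<longleftrightarrow> (\<forall>s\<in>D. (\<exists>n\<in>D. mlength s n) \<longrightarrow>
     sat D E T (e(fresh ts := s)) (P (Var (fresh ts))))"
  by (simp add: AllStr_def is_string_def)

lemma sat_fm_all_one:
  "sat D E T e (fm_all_one M) \<longleftrightarrow> (\<forall>s\<in>D. (\<exists>n\<in>D. mlength s n) \<longrightarrow> mcomputes M s One)"
  by (simp add: fm_all_one_def)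

lemma sat_fm_zero_or_one:
  "sat D E T e (fm_zero_or_one M) \<longleftrightarrow>
     (\<forall>s\<in>D. (\<exists>n\<in>D. mlength s n) \<longrightarrow> mcomputes M s Zero \<or> mcomputes M s One)"
  by (simp add: fm_zero_or_one_def)

lemma sat_fm_one_downward:
  "sat D E T e (fm_one_downward M) \<longleftrightarrow>
     (\<forall>r\<in>D. (\<exists>n\<in>D. mlength r n) \<longrightarrow> (\<forall>s\<in>D. (\<exists>n\<in>D. mlength s n) \<longrightarrow>
       (\<exists>n\<in>D. \<exists>m\<in>D. mlength s n \<and> mlength r m \<and> E m n) \<longrightarrow>
       mcomputes M s One \<longrightarrow> mcomputes M r One))"
  by (simp add: fm_one_downward_def longer_def)

end

section \<open>Formulas free of \<open>Tab\<close>\<close>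

lemma pure_Con [simp]: "pure (Con A B) \<longleftrightarrow> pure A \<and> pure B"
  by (simp add: Con_def)

lemma pure_Dis [simp]: "pure (Dis A B) \<longleftrightarrow> pure A \<and> pure B"
  by (simp add: Dis_def)

lemma pure_Iff [simp]: "pure (Iff A B) \<longleftrightarrow> pure A \<and> pure B"
  by (auto simp: Iff_def)

lemma pure_Exists [simp]: "pure (Exists x A) \<longleftrightarrow> pure A"
  by (simp add: Exists_def)

lemma pure_AllF [simp]: "pure (AllF ts P) \<longleftrightarrow> pure (P (Var (fresh ts)))"
  by (simp add: AllF_def)

lemma pure_ExF [simp]: "pure (ExF ts P) \<longleftrightarrow> pure (P (Var (fresh ts)))"
  by (simp add: ExF_def)

lemma pure_subst: "pure A \<Longrightarrow> pure (subst x (Var y) A)"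
proof (induction A)
  case (Eq a b)
  then show ?case by (cases a; cases b) auto
next
  case (Mem a b)
  then show ?case by (cases a; cases b) auto
qed auto

lemma pure_is_num: "a \<noteq> Tab \<Longrightarrow> pure (is_num n a)"
  by (induction n arbitrary: a) (simp_all add: is_empty_def is_succ_def)

lemma pure_is_pair: "a \<noteq> Tab \<Longrightarrow> b \<noteq> Tab \<Longrightarrow> c \<noteq> Tab \<Longrightarrow> pure (is_pair c a b)"
  by (simp add: is_pair_def is_upair_def)

text \<open>The schemes are restricted to pure formulas, so the truth of all axioms is independent
  of the element interpreting \<open>Tab\<close>.\<close>

lemma pure_ZFC_axiom: "ZFC_axiom A \<Longrightarrow> pure A"
  by (induction rule: ZFC_axiom.induct)
    (simp_all add: ax_extensionality_def ax_foundation_def ax_pairing_def ax_union_def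
      ax_powerset_def ax_infinity_def ax_choice_def is_upair_def is_inductive_def is_empty_def
      is_succ_def pure_subst)

section \<open>Models of ZFC\<close>

text \<open>\<open>T\<close> is arbitrary because \<open>Tab\<close> is going to be interpreted by a
  table found inside the model. The natural numbers of the model may be nonstandard.\<close>

locale ZFC_model = membership_structure D E
  for D :: "'u set" and E :: "'u \<Rightarrow> 'u \<Rightarrow> bool" +
  assumes ZFC_axiom_sat: "ZFC_axiom A \<Longrightarrow> T \<in> D \<Longrightarrow> (\<And>x. e x \<in> D) \<Longrightarrow> sat D E T e A"
begin

lemma ZFC_axiom_sat': "ZFC_axiom A \<Longrightarrow> d \<in> D \<Longrightarrow> sat D E d (\<lambda>_. d) A"
  by (rule ZFC_axiom_sat)

lemma extensionality:
  "a \<in> D \<Longrightarrow> b \<in> D \<Longrightarrow> (\<And>x. x \<in> D \<Longrightarrow> E x a \<longleftrightarrow> E x b) \<Longrightarrow> a = b"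
  using ZFC_axiom_sat'[OF ZFC_axiom.extensionality] by (simp add: ax_extensionality_def)

lemma upair_ex: "a \<in> D \<Longrightarrow> b \<in> D \<Longrightarrow> \<exists>c\<in>D. mupair c a b"
  using ZFC_axiom_sat'[OF ZFC_axiom.pairing] by (simp add: ax_pairing_def)

lemma inductive_ex: "d \<in> D \<Longrightarrow> \<exists>w\<in>D. minductive w"
  using ZFC_axiom_sat'[OF ZFC_axiom.infinity, of d] by (simp add: ax_infinity_def)

lemma not_self_member:
  assumes "a \<in> D" shows "\<not> E a a"
proof
  assume "E a a"
  \<comment> \<open>Foundation is applied to the singleton of \<open>a\<close>.\<close>
  obtain c where c: "c \<in> D" "mupair c a a" using upair_ex assms by blast
  then have "\<exists>x\<in>D. E x c" using assms by (auto simp: mupair_def)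
  then have "\<exists>x\<in>D. E x c \<and> \<not> (\<exists>y\<in>D. E y x \<and> E y c)"
    using ZFC_axiom_sat'[OF ZFC_axiom.foundation c(1)] c(1) by (auto simp: ax_foundation_def)
  then show False using c assms \<open>E a a\<close> by (auto simp: mupair_def)
qed

lemma separation:
  assumes A: "pure A" and a: "a \<in> D" and e: "\<And>x. e x \<in> D"
  shows "\<exists>y\<in>D. \<forall>x\<in>D. E x y \<longleftrightarrow> E x a \<and> sat D E T (e(v := x)) A"
proof -
  obtain k where k: "k \<notin> all_vars A" "k \<noteq> v"
    using ex_new_if_finite[of "insert v (all_vars A)"] by auto
  obtain l where l: "l \<notin> all_vars A" "l \<noteq> v" "l \<noteq> k"
    using ex_new_if_finite[of "insert k (insert v (all_vars A))"] by auto
  have fvA: "k \<notin> fv A" "l \<notin> fv A" using k l fv_subset_all_vars by blast+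
  have "ZFC_axiom (Forall l (Exists k (Forall v
      (Var v \<^bold>\<in> Var k \<^bold>\<longleftrightarrow> Var v \<^bold>\<in> Var l \<^bold>\<and> A))))"
    by (rule ZFC_axiom.separation) (use A k l fvA in auto)
  \<comment> \<open>Here \<open>a\<close> stands in for the interpretation of \<open>Tab\<close>;
    purity of \<open>A\<close> exchanges it for \<open>T\<close>, which need not lie in
    \<open>D\<close>.\<close>
  from ZFC_axiom_sat[OF this a e] a
  have "\<exists>y\<in>D. \<forall>x\<in>D. E x y \<longleftrightarrow> E x a \<and> sat D E a (e(l := a, k := y, v := x)) A"
    using k l by (simp add: val.simps)
  moreover have "sat D E a (e(l := a, k := y, v := x)) A \<longleftrightarrow> sat D E T (e(v := x)) A" for x y
    unfolding sat_pure[OF A, of _ _ a _ T] using fvA by (intro sat_cong) auto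
  ultimately show ?thesis by simp
qed

lemma replacement:
  assumes A: "pure A" and a: "a \<in> D" and e: "\<And>x. e x \<in> D" and vw: "v \<noteq> w"
    and functional: "\<And>x y y'. x \<in> D \<Longrightarrow> y \<in> D \<Longrightarrow> y' \<in> D \<Longrightarrow> E x a \<Longrightarrow>
      sat D E T (e(v := x, w := y)) A \<Longrightarrow> sat D E T (e(v := x, w := y')) A \<Longrightarrow> y = y'"
  shows "\<exists>b\<in>D. \<forall>y\<in>D. E y b \<longleftrightarrow> (\<exists>x\<in>D. E x a \<and> sat D E T (e(v := x, w := y)) A)"
proof -
  obtain k where k: "k \<notin> all_vars A" "k \<noteq> v" "k \<noteq> w"
    using ex_new_if_finite[of "insert w (insert v (all_vars A))"] by auto
  obtain l where l: "l \<notin> all_vars A" "l \<noteq> v" "l \<noteq> w" "l \<noteq> k"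
    using ex_new_if_finite[of "insert k (insert w (insert v (all_vars A)))"] by auto
  \<comment> \<open>Since \<open>w'\<close> does not occur in \<open>A\<close>, the substitution
    lemma evaluates the second copy of \<open>A\<close> in the scheme.\<close>
  obtain w' where w': "w' \<notin> all_vars A" "w' \<noteq> v" "w' \<noteq> w" "w' \<noteq> k" "w' \<noteq> l"
    using ex_new_if_finite[of "insert l (insert k (insert w (insert v (all_vars A))))"] by auto
  have fvA: "k \<notin> fv A" "l \<notin> fv A" "w' \<notin> fv A" using k l w' fv_subset_all_vars by blast+
  have "ZFC_axiom (Forall l
      (Forall v (Var v \<^bold>\<in> Var l \<^bold>\<longrightarrow>
         Forall w (Forall w' (A \<^bold>\<and> subst w (Var w') A \<^bold>\<longrightarrow> Var w \<^bold>= Var w')))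
       \<^bold>\<longrightarrow> Exists k (Forall w (Var w \<^bold>\<in> Var k \<^bold>\<longleftrightarrow> Exists v (Var v \<^bold>\<in> Var l \<^bold>\<and> A)))))"
    by (rule ZFC_axiom.replacement) (use A k l w' vw fvA in auto)
  from ZFC_axiom_sat[OF this a e] a
  have "(\<forall>x\<in>D. E x a \<longrightarrow> (\<forall>y\<in>D. \<forall>y'\<in>D. sat D E a (e(l := a, v := x, w := y, w' := y')) A \<and>
       sat D E a (e(l := a, v := x, w := y, w' := y', w := y')) A \<longrightarrow> y = y')) \<longrightarrow>
     (\<exists>b\<in>D. \<forall>y\<in>D. E y b \<longleftrightarrow> (\<exists>x\<in>D. E x a \<and> sat D E a (e(l := a, k := b, w := y, v := x)) A))"
    using k l w' vw
    by (simp add: val.simps sat_subst[OF free_for_Var_notin_all_vars[OF w'(1)]] del: fun_upd_upd)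
  moreover have "sat D E a (e(l := a, v := x, w := y, w' := y')) A \<longleftrightarrow>
      sat D E T (e(v := x, w := y)) A"
    "sat D E a (e(l := a, v := x, w := y, w' := y', w := y')) A \<longleftrightarrow>
      sat D E T (e(v := x, w := y')) A"
    "sat D E a (e(l := a, k := b, w := y, v := x)) A \<longleftrightarrow>
      sat D E T (e(v := x, w := y)) A" for x y y' b
    unfolding sat_pure[OF A, of _ _ a _ T] using fvA vw by (auto intro!: sat_cong)
  ultimately show ?thesis using functional by (simp del: fun_upd_apply)
qed

text \<open>Members collected in a HOL set reduce facts about unordered and Kuratowski pairs to
  facts about finite HOL sets.\<close>

definition ext :: "'u \<Rightarrow> 'u set" where
  "ext a = {x \<in> D. E x a}"

lemma ext_inj: "a \<in> D \<Longrightarrow> b \<in> D \<Longrightarrow> ext a = ext b \<Longrightarrow> a = b"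
  by (rule extensionality) (auto simp: ext_def)

lemma mupair_iff: "a \<in> D \<Longrightarrow> b \<in> D \<Longrightarrow> mupair c a b \<longleftrightarrow> ext c = {a, b}"
  by (auto simp: mupair_def ext_def)

lemma mpair_iff:
  assumes "a \<in> D" "b \<in> D"
  shows "mpair c a b \<longleftrightarrow> (\<exists>u\<in>D. \<exists>v\<in>D. ext u = {a} \<and> ext v = {a, b} \<and> ext c = {u, v})"
  using assms by (auto simp: mpair_def mupair_iff)

lemma mpair_ex: "a \<in> D \<Longrightarrow> b \<in> D \<Longrightarrow> \<exists>c\<in>D. mpair c a b"
  unfolding mpair_def using upair_ex by meson

lemma mpair_unique:
  assumes "a \<in> D" "b \<in> D" "c \<in> D" "c' \<in> D" "mpair c a b" "mpair c' a b"
  shows "c = c'"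
proof -
  obtain u v where "u \<in> D" "v \<in> D" "ext u = {a}" "ext v = {a, b}" "ext c = {u, v}"
    using assms by (auto simp: mpair_iff)
  moreover obtain u' v' where "u' \<in> D" "v' \<in> D" "ext u' = {a}" "ext v' = {a, b}" "ext c' = {u', v'}"
    using assms by (auto simp: mpair_iff)
  ultimately show ?thesis using ext_inj assms(3,4) by metis
qed

lemma mpair_inject:
  assumes "a \<in> D" "b \<in> D" "a' \<in> D" "b' \<in> D" "mpair c a b" "mpair c a' b'"
  shows "a = a'" "b = b'"
proof -
  obtain u v where "ext u = {a}" "ext v = {a, b}" "ext c = {u, v}"
    using assms by (auto simp: mpair_iff)
  moreover obtain u' v' where "ext u' = {a'}" "ext v' = {a', b'}" "ext c = {u', v'}"
    using assms by (auto simp: mpair_iff)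
  ultimately show "a = a'" "b = b'" by (metis doubleton_eq_iff singleton_insert_inj_eq')+
qed

section \<open>Numerals and natural numbers of the model\<close>

lemma mempty_unique: "a \<in> D \<Longrightarrow> b \<in> D \<Longrightarrow> mempty a \<Longrightarrow> mempty b \<Longrightarrow> a = b"
  by (rule extensionality) (auto simp: mempty_def)

lemma msucc_unique: "a \<in> D \<Longrightarrow> b \<in> D \<Longrightarrow> msucc a x \<Longrightarrow> msucc b x \<Longrightarrow> a = b"
  by (rule extensionality) (auto simp: msucc_def)

lemma mnum_unique: "a \<in> D \<Longrightarrow> b \<in> D \<Longrightarrow> mnum n a \<Longrightarrow> mnum n b \<Longrightarrow> a = b"
proof (induction n arbitrary: a b)
  case (Suc n)
  then obtain a' b' where "a' \<in> D" "mnum n a'" "msucc a a'" "b' \<in> D" "mnum n b'" "msucc b b'"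
    by auto
  with Suc show ?case using msucc_unique by metis
qed (use mempty_unique in simp)

text \<open>\<open>minductive\<close> provides only some empty element and some successors; by
  extensionality they are the given ones.\<close>

lemma minductive_zero: "w \<in> D \<Longrightarrow> minductive w \<Longrightarrow> z \<in> D \<Longrightarrow> mempty z \<Longrightarrow> E z w"
  unfolding minductive_def using mempty_unique by blast

lemma minductive_succ:
  "w \<in> D \<Longrightarrow> minductive w \<Longrightarrow> x \<in> D \<Longrightarrow> y \<in> D \<Longrightarrow> E x w \<Longrightarrow> msucc y x \<Longrightarrow> E y w"
  unfolding minductive_def using msucc_unique by blast

lemma mnat_zero: "z \<in> D \<Longrightarrow> mempty z \<Longrightarrow> mnat z"
  unfolding mnat_def using minductive_zero by blast

lemma mnat_succ: "x \<in> D \<Longrightarrow> y \<in> D \<Longrightarrow> mnat x \<Longrightarrow> msucc y x \<Longrightarrow> mnat y"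
  unfolding mnat_def using minductive_succ by blast

text \<open>The successor is taken from an inductive set, which contains \<open>x\<close>, without
  an appeal to the union axiom.\<close>

lemma msucc_ex:
  assumes "x \<in> D" "mnat x"
  obtains y where "y \<in> D" "mnat y" "msucc y x"
proof -
  obtain w where w: "w \<in> D" "minductive w" using inductive_ex assms by blast
  then have "E x w" using assms unfolding mnat_def by blast
  then obtain y where "y \<in> D" "msucc y x" using w assms unfolding minductive_def by blast
  then show thesis using that mnat_succ assms by blast
qed

lemma mnum_ex:
  assumes "d \<in> D"
  obtains x where "x \<in> D" "mnum n x" "mnat x"
proof (induction n arbitrary: thesis)
  case 0
  obtain w where "w \<in> D" "minductive w" using inductive_ex assms by blast
  then show ?case using 0 mnat_zero unfolding minductive_def by auto
next
  case (Suc n)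
  obtain x where x: "x \<in> D" "mnum n x" "mnat x" using Suc.IH by blast
  then obtain y where "y \<in> D" "mnat y" "msucc y x" using msucc_ex by blast
  then show ?case using Suc.prems x by auto
qed

text \<open>Restricted to properties given by a pure formula, as the natural numbers may be
  nonstandard: separation cuts from an inductive set the elements satisfying \<open>A\<close>, and
  the result is again inductive. Variables other than \<open>v\<close> get the default value
  \<open>a\<close>.\<close>

lemma mnat_induct:
  assumes A: "pure A" and a: "a \<in> D" "mnat a"
    and zero: "\<And>z. z \<in> D \<Longrightarrow> mempty z \<Longrightarrow> sat D E a ((\<lambda>_. a)(v := z)) A"
    and succ: "\<And>x y. x \<in> D \<Longrightarrow> y \<in> D \<Longrightarrow> msucc y x \<Longrightarrow> sat D E a ((\<lambda>_. a)(v := x)) A \<Longrightarrow>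
      sat D E a ((\<lambda>_. a)(v := y)) A"
  shows "sat D E a ((\<lambda>_. a)(v := a)) A"
proof -
  obtain w where w: "w \<in> D" "minductive w" using inductive_ex a by blast
  obtain y where y: "y \<in> D"
    "\<And>x. x \<in> D \<Longrightarrow> E x y \<longleftrightarrow> E x w \<and> sat D E a ((\<lambda>_. a)(v := x)) A"
    using separation[OF A w(1), of "\<lambda>_. a" a v] a by blast
  have "minductive y"
    unfolding minductive_def
  proof (intro conjI ballI impI)
    show "\<exists>z\<in>D. mempty z \<and> E z y"
      using w y zero unfolding minductive_def by blast
    fix x assume x: "x \<in> D" "E x y"
    then obtain x' where "x' \<in> D" "msucc x' x" "E x' w"
      using w y unfolding minductive_def by blast
    then show "\<exists>x'\<in>D. msucc x' x \<and> E x' y" using x y succ by blast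
  qed
  then have "E a y" using a y unfolding mnat_def by blast
  then show ?thesis using y a by blast
qed

text \<open>With \<open>j\<close> fixed outside the model, the claim is a finite disjunction and
  thus a formula, to which induction inside the model applies. It locates a possibly nonstandard
  number relative to the numeral \<open>j\<close> without developing the order of the natural
  numbers.\<close>

lemma mnat_cases_mnum:
  assumes a: "a \<in> D" "mnat a"
  shows "(\<exists>i<j. mnum i a) \<or> (\<exists>y\<in>D. mnum j y \<and> (E y a \<or> y = a))"
proof -
  define P where "P x \<longleftrightarrow> (\<exists>i<j. mnum i x) \<or> (\<exists>y\<in>D. mnum j y \<and> (E y x \<or> y = x))" for x
  define A where "A = foldr Dis (map (\<lambda>i. is_num i (Var 0)) [0..<j])
    (ExNum [Var 0] j (\<lambda>y. y \<^bold>\<in> Var 0 \<^bold>\<or> y \<^bold>= Var 0))"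
  have "pure (foldr Dis L B) \<longleftrightarrow> (\<forall>C\<in>set L. pure C) \<and> pure B" for L B
    by (induction L) auto
  then have "pure A" by (simp add: A_def ExNum_def pure_is_num)
  moreover have sat_A: "sat D E T (e(0 := x)) A \<longleftrightarrow> P x" for T e x
    by (auto simp: A_def P_def sat_foldr_Dis)
  moreover have "P z" if "z \<in> D" "mempty z" for z
  proof (cases j)
    case 0
    then show ?thesis using that by (auto simp: P_def)
  next
    case (Suc i)
    then show ?thesis using that by (auto simp: P_def intro!: exI[of _ 0])
  qed
  moreover have "P y" if xy: "x \<in> D" "y \<in> D" "msucc y x" and x: "P x" for x y
    using x[unfolded P_def]
  proof
    assume "\<exists>i<j. mnum i x"
    then obtain i where "i < j" "mnum (Suc i) y" using xy by auto
    then show ?thesis using xy by (cases "Suc i = j") (auto simp: P_def intro!: exI[of _ "Suc i"])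
  next
    assume "\<exists>z\<in>D. mnum j z \<and> (E z x \<or> z = x)"
    then show ?thesis using xy by (auto simp: P_def msucc_def)
  qed
  ultimately have "sat D E a ((\<lambda>_. a)(0 := a)) A"
    using a by (intro mnat_induct) auto
  then show ?thesis unfolding sat_A P_def .
qed

text \<open>External induction on \<open>k\<close>: each passage to a successor takes in one more
  standard numeral.\<close>

lemma large_nat_ex:
  assumes l: "l \<in> D" "mnat l"
  shows "\<exists>n\<in>D. mnat n \<and> E l n \<and> (\<forall>j<k. \<exists>y\<in>D. mnum j y \<and> E y n)"
proof (induction k)
  case 0
  then show ?case using msucc_ex[OF l] l by (metis msucc_def not_less_zero)
next
  case (Suc k)
  then obtain n where n: "n \<in> D" "mnat n" "E l n" "\<forall>j<k. \<exists>y\<in>D. mnum j y \<and> E y n" by blast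
  obtain n' where n': "n' \<in> D" "mnat n'" "msucc n' n" using msucc_ex n by blast
  have sub: "E x n'" if "x \<in> D" "E x n \<or> x = n" for x
    using n'(3) that unfolding msucc_def by blast
  \<comment> \<open>The numeral \<open>i\<close> is an element of \<open>n\<close>, hence not
    \<open>n\<close> itself; the case distinction then leaves the numeral \<open>k\<close> in or
    equal to \<open>n\<close>, that is, in \<open>n'\<close>.\<close>
  have "\<not> mnum i n" if "i < k" for i
    using n that mnum_unique not_self_member by blast
  then obtain y where "y \<in> D" "mnum k y" "E y n'"
    using mnat_cases_mnum[OF n(1,2), of k] sub by blast
  then have "\<forall>j<Suc k. \<exists>y\<in>D. mnum j y \<and> E y n'"
    using n(4) sub by (metis less_Suc_eq)
  then show ?case using n n' l sub by blast
qed

text \<open>The constant function is the image of \<open>n\<close> under pairing with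
  \<open>one\<close>, a set by replacement.\<close>

lemma ones_string_ex:
  assumes n: "n \<in> D" "mnat n" and one: "one \<in> D" "mnum 1 one"
  obtains s where "s \<in> D" "mlength s n" "\<And>k. k \<in> D \<Longrightarrow> E k n \<Longrightarrow> mapp s k one"
proof -
  \<comment> \<open>Variable 0 is the argument and 2 the value; 3 is a parameter that the constant
    assignment sets to \<open>one\<close>.\<close>
  define A where "A = is_pair (Var 2) (Var 0) (Var 3)"
  let ?e = "(\<lambda>_. one)"
  have sat_A: "sat D E T (?e(0 := x, 2 := y)) A \<longleftrightarrow> mpair y x one" for T x y
    by (simp add: A_def val.simps)
  have "pure A" by (simp add: A_def pure_is_pair)
  then have "\<exists>s\<in>D. \<forall>y\<in>D. E y s \<longleftrightarrow> (\<exists>x\<in>D. E x n \<and> sat D E n (?e(0 := x, 2 := y)) A)"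
    by (rule replacement[OF _ n(1)])
      (use one mpair_unique in \<open>auto simp: sat_A simp del: fun_upd_apply\<close>)
  then obtain s where s: "s \<in> D" "\<And>y. y \<in> D \<Longrightarrow> E y s \<longleftrightarrow> (\<exists>x\<in>D. E x n \<and> mpair y x one)"
    unfolding sat_A by blast
  have app: "mapp s k one" if "k \<in> D" "E k n" for k
    unfolding mapp_def using s mpair_ex[OF that(1) one(1)] that by blast
  have "c = one" if "k \<in> D" "c \<in> D" "mapp s k c" for k c
    using that s mpair_inject(2)[OF that(1,2) _ one(1)] unfolding mapp_def by blast
  then have "mlength s n"
    unfolding mlength_def using n(2) s one app by blast
  then show thesis using that s app by blast
qed

text \<open>\<open>Tab\<close> is interpreted as the table of a string of ones longer than
  \<open>r\<close> and at least as long as the input of the proof; of all entries of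
  \<open>T_list\<close> only \<open>input_blank\<close> can fail there.\<close>

lemma all_one_if_short_proof:
  assumes \<pi>: "normal_proof M (replicate n True) One \<pi>" "input_blank M n Tab \<notin> set \<pi>"
    and zero_or_one: "sat D E T e (fm_zero_or_one M)"
    and one_downward: "sat D E T e (fm_one_downward M)"
  shows "sat D E T e (fm_all_one M)"
  unfolding sat_fm_all_one
proof (intro ballI impI)
  fix r assume r: "r \<in> D" "\<exists>l\<in>D. mlength r l"
  then obtain l where l: "l \<in> D" "mlength r l" by blast
  then have "mnat l" by (simp add: mlength_def)
  then obtain n' where n': "n' \<in> D" "mnat n'" "E l n'"
    and large: "\<And>j. j < n \<Longrightarrow> \<exists>y\<in>D. mnum j y \<and> E y n'"
    using large_nat_ex l by blast
  obtain one where one: "one \<in> D" "mnum 1 one" using mnum_ex r(1) by blast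
  obtain s where s: "s \<in> D" "mlength s n'" and ones: "\<And>k. k \<in> D \<Longrightarrow> E k n' \<Longrightarrow> mapp s k one"
    using ones_string_ex n' one by blast
  \<comment> \<open>Either value will do: only the table is taken from it.\<close>
  have "mcomputes M s Zero \<or> mcomputes M s One"
    using zero_or_one s n' unfolding sat_fm_zero_or_one by blast
  then obtain t where t: "t \<in> D" "mtable M t" "minput M t s"
    unfolding mcomputes_def by blast
  then obtain n'' z where n'': "n'' \<in> D" "mlength s n''" and z: "z \<in> D" "mnum 0 z"
    and left: "mcell t z z LeftEnd (start M) 1"
    and bits: "\<And>k j b. k \<in> D \<Longrightarrow> j \<in> D \<Longrightarrow> b \<in> D \<Longrightarrow> E k n'' \<Longrightarrow> msucc j k \<Longrightarrow> mapp s k b \<Longrightarrow>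
        \<exists>q\<in>D. mnum (start M) q \<and> (\<exists>h\<in>D. mnum 0 h \<and> mentry t z j b q h)"
    unfolding minput_def by blast
  \<comment> \<open>\<open>minput\<close> supplies some length \<open>n''\<close> of
    \<open>s\<close>, a priori different from \<open>n'\<close>. This inclusion suffices, and it
    holds because a position carrying a bit lies in every length of \<open>s\<close>.\<close>
  have dom: "E k n''" if k: "k \<in> D" "E k n'" for k
  proof -
    obtain p where "p \<in> D" "mpair p k one" "E p s" using ones[OF k] unfolding mapp_def by blast
    moreover then obtain k' b where "k' \<in> D" "b \<in> D" "E k' n''" "mpair p k' b"
      using n''(2) unfolding mlength_def by blast
    ultimately show ?thesis using mpair_inject(1)[OF k(1) one(1)] by blast
  qed
  have input: "sat D E t e' (input_cell (Suc k) Tab One (start M) 0)" if k: "k < n" for k e'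
  proof -
    obtain y where y: "y \<in> D" "mnum k y" "E y n'" using large[OF k] by blast
    \<comment> \<open>Bit \<open>k\<close> sits in cell \<open>k + 1\<close>, as cell 0 holds the
      left-end marker.\<close>
    then obtain j where j: "j \<in> D" "msucc j y"
      using msucc_ex mnum_ex[OF r(1), of k] mnum_unique by metis
    have "\<exists>q\<in>D. mnum (start M) q \<and> (\<exists>h\<in>D. mnum 0 h \<and> mentry t z j one q h)"
      by (rule bits) (use y j one dom ones in auto)
    then have "mcell t z j One (start M) 0" using one by (auto simp: mcell_def)
    moreover have "mnum (Suc k) j" using y j by auto
    ultimately show ?thesis using z j by auto
  qed
  have "sat D E t (\<lambda>_. t) (ExNum [Tab] (sym_code One) (\<lambda>x. outputs M Tab x))"
    using \<pi>(1) unfolding normal_proof_def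
  proof (rule proves_sat)
    fix B and e' :: "nat \<Rightarrow> 'u"
    assume "B \<in> set (T_list M (replicate n True))" "B \<in> set \<pi>"
    then consider "B \<in> set (def_M M Tab)" | "B = input_cell 0 Tab LeftEnd (start M) 1"
      | k where "k < n" "B = input_cell (Suc k) Tab One (start M) 0"
      using \<pi>(2) by (auto simp: T_list_def input_fms_def bit_sym_def)
    then show "sat D E t e' B"
    proof cases
      case 1
      then show ?thesis using t(2) by (simp add: mtable_def)
    next
      case 2
      then show ?thesis using z left by auto
    next
      case 3
      then show ?thesis using input by simp
    qed
  qed (use t(1) ZFC_axiom_sat in auto)
  \<comment> \<open>The output 1 appears in \<open>t\<close> itself, so no uniqueness of tables
    enters.\<close>
  then have "mcomputes M s One"
    using t by (auto simp: mcomputes_def simp del: mnum.simps)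
  then show "mcomputes M r One"
    using one_downward r l s n' unfolding sat_fm_one_downward by blast
qed

end

section \<open>Contradiction from a uniform bound on proof lengths\<close>

theorem theorem3p24:
  fixes M :: turing_machine
  assumes "is_TM M"
    and "\<forall>s::bitstring. halts_on M s"
    and "ZFC_provable (fm_length_only M)"
    and "ZFC_provable (fm_one_downward M)"
    and "ZFC_provable (fm_zero_upward M)"
    and "ZFC_provable (fm_zero_or_one M)"
    and "ZFC_provable (fm_threshold M)"
    and "ZFC_independent (fm_all_one M)"
  shows "\<forall>m::nat. \<exists>s::bitstring. FS M s One > enat m"
proof (rule ccontr)
  assume "\<not> ?thesis"
  then obtain m where m: "\<And>s. FS M s One \<le> enat m" by (auto simp: not_less)
  have "\<exists>\<pi>. normal_proof M (replicate m True) One \<pi> \<and> ascii_norm \<pi> \<le> m"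
  proof (rule ccontr)
    assume "\<not> ?thesis"
    \<comment> \<open>Norms exceeding \<open>m\<close> are at least \<open>Suc m\<close>; the case
      without any proof, where the infimum is infinite, is covered as well.\<close>
    then have "enat (Suc m) \<le> FS M (replicate m True) One"
      unfolding FS_def by (intro INF_greatest) (auto simp: not_le)
    then show False using m[of "replicate m True"] by (metis Suc_n_not_le_n enat_ord_simps(1) order_trans)
  qed
  then obtain \<pi> where \<pi>: "normal_proof M (replicate m True) One \<pi>" "ascii_norm \<pi> \<le> m" by blast
  have no_blank: "input_blank M m Tab \<notin> set \<pi>"
    using qdepth_input_blank[of m M Tab] qdepth_le_asciilen[of "input_blank M m Tab"]
      asciilen_le_ascii_norm[of "input_blank M m Tab" \<pi>] \<pi>(2) by linarith
  have "\<not> ZFC_provable (fm_all_one M)"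
    using assms(8) by (simp add: ZFC_independent_def)
  then obtain D :: "tm set set" and E T e where
    model: "\<not> sat D E T e (fm_all_one M)" "T \<in> D" "\<And>x. e x \<in> D"
      "\<And>B e. ZFC_provable B \<Longrightarrow> (\<And>x. e x \<in> D) \<Longrightarrow> sat D E T e B"
    by (rule ZFC_completeness) (erule that; auto)
  interpret ZFC_model D E
  proof
    fix A T' and e' :: "nat \<Rightarrow> tm set"
    assume A: "ZFC_axiom A" and "\<And>x. e' x \<in> D"
    then have "sat D E T e' A" by (intro model(4) ZFC_provable_axiom)
    \<comment> \<open>Completeness gives validity for the single interpretation \<open>T\<close> of
      \<open>Tab\<close>; purity extends it to every \<open>T'\<close>.\<close>
    then show "sat D E T' e' A" using sat_pure[OF pure_ZFC_axiom[OF A]] by metis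
  qed
  have "sat D E T e (fm_all_one M)"
    by (rule all_one_if_short_proof[OF \<pi>(1) no_blank]) (intro model(3,4) assms)+
  with model(1) show False by contradiction
qed

end
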